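(* Let $G$ be a group acting 3-discontinuously and 2-cocompactly on a compactum $X=\Lambda G\sqcup A$ with $A\neq\varnothing$. Suppose $H$ is a subgroup of $G$ acting cocompactly on $X\setminus\Lambda H$. If $G$ is finitely presented, then $H$ is finitely presented.
   Context: A compactum is a compact Hausdorff space; $\Theta^nX$ is the space of $n$-element subsets of $X$. An action of a discrete group $G$ on $X$ by homeomorphisms is 3-discontinuous if the induced action on $\Theta^3X$ is properly discontinuous, and 2-cocompact if the induced action on $\Theta^2X$ is cocompact. The discontinuity domain $A$ is the set of points $x$ having a neighborhood $U$ with $gU\cap U\ne\varnothing$ for only finitely many $g\in G$; the limit set $\Lambda G$ is its complement, and $\Lambda H$ is the limit set of $H$ acting on $X$. Standing assumptions: $|X|>2$ and $A$ is nonempty, discrete and $G$-finite ($|A/G|<\infty$). *)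

theory Defs
  imports "HOL-Analysis.Analysis" "HOL-Algebra.Group_Action"
begin

section \<open>Spaces of finite subsets\<close>

definition Theta_set :: "nat \<Rightarrow> 'x topology \<Rightarrow> 'x set set" where
  "Theta_set n X = {S. S \<subseteq> topspace X \<and> finite S \<and> card S = n}"

definition Conf :: "nat \<Rightarrow> 'x topology \<Rightarrow> (nat \<Rightarrow> 'x) topology" where
  "Conf n X = subtopology (product_topology (\<lambda>_. X) {..<n}) {f. inj_on f {..<n}}"

text \<open>The space of \<open>n\<close>-element subsets carries the quotient topology of the space of ordered
  \<open>n\<close>-tuples of distinct points with respect to the map that forgets the order (see
  \<open>quotient_map_Theta\<close>).\<close>

definition Theta :: "nat \<Rightarrow> 'x topology \<Rightarrow> 'x set topology" where
  "Theta n X = topology (\<lambda>U. U \<subseteq> Theta_set n X \<and>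
     openin (Conf n X) {f \<in> topspace (Conf n X). f ` {..<n} \<in> U})"

lemma openin_Theta:
  "openin (Theta n X) U \<longleftrightarrow> U \<subseteq> Theta_set n X \<and>
     openin (Conf n X) {f \<in> topspace (Conf n X). f ` {..<n} \<in> U}"
proof -
  let ?pre = "\<lambda>U. {f \<in> topspace (Conf n X). f ` {..<n} \<in> U}"
  have "istopology (\<lambda>U. U \<subseteq> Theta_set n X \<and> openin (Conf n X) (?pre U))"
    unfolding istopology_def
  proof (intro conjI allI impI)
    fix S T
    assume "S \<subseteq> Theta_set n X \<and> openin (Conf n X) (?pre S)"
      and "T \<subseteq> Theta_set n X \<and> openin (Conf n X) (?pre T)"
    moreover have "?pre (S \<inter> T) = ?pre S \<inter> ?pre T"
      by blast
    ultimately show "S \<inter> T \<subseteq> Theta_set n X" "openin (Conf n X) (?pre (S \<inter> T))"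
      by auto
  next
    fix \<K>
    assume *: "\<forall>K\<in>\<K>. K \<subseteq> Theta_set n X \<and> openin (Conf n X) (?pre K)"
    then show "\<Union>\<K> \<subseteq> Theta_set n X"
      by blast
    have "?pre (\<Union>\<K>) = \<Union>(?pre ` \<K>)"
      by blast
    with * show "openin (Conf n X) (?pre (\<Union>\<K>))"
      by (metis (mono_tags, lifting) imageE openin_Union)
  qed
  then show ?thesis
    unfolding Theta_def by (simp add: topology_inverse')
qed

lemma Conf_image_in_Theta_set:
  assumes "f \<in> topspace (Conf n X)"
  shows "f ` {..<n} \<in> Theta_set n X"
  using assms by (auto simp: Conf_def Theta_set_def card_image PiE_iff)

lemma topspace_Theta [simp]: "topspace (Theta n X) = Theta_set n X"
proof (rule antisym)
  show "topspace (Theta n X) \<subseteq> Theta_set n X"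
    using openin_Theta openin_topspace by blast
  have "{f \<in> topspace (Conf n X). f ` {..<n} \<in> Theta_set n X} = topspace (Conf n X)"
    using Conf_image_in_Theta_set by blast
  then have "openin (Theta n X) (Theta_set n X)"
    by (simp add: openin_Theta)
  then show "Theta_set n X \<subseteq> topspace (Theta n X)"
    by (rule openin_subset)
qed

lemma Theta_set_eq_image: "(\<lambda>f. f ` {..<n}) ` topspace (Conf n X) = Theta_set n X"
proof (intro antisym subsetI)
  fix S assume "S \<in> Theta_set n X"
  then have S: "S \<subseteq> topspace X" "finite S" "card S = n"
    by (auto simp: Theta_set_def)
  then obtain h where h: "bij_betw h {..<n} S"
    using ex_bij_betw_nat_finite atLeast0LessThan by metis
  have "restrict h {..<n} \<in> topspace (Conf n X)"
    using h S by (auto simp: Conf_def bij_betw_def inj_on_def)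
  moreover have "restrict h {..<n} ` {..<n} = S"
    using h by (simp add: bij_betw_def)
  ultimately show "S \<in> (\<lambda>f. f ` {..<n}) ` topspace (Conf n X)"
    by blast
qed (use Conf_image_in_Theta_set in blast)

lemma quotient_map_Theta: "quotient_map (Conf n X) (Theta n X) (\<lambda>f. f ` {..<n})"
  unfolding quotient_map_def by (simp add: openin_Theta Theta_set_eq_image)


section \<open>Actions on topological spaces\<close>

text \<open>In what follows \<open>H\<close> is the set of acting group elements, so that the notions apply
  equally to a group and to its subgroups.\<close>

definition properly_discontinuous :: "'y topology \<Rightarrow> 'g set \<Rightarrow> ('g \<Rightarrow> 'y \<Rightarrow> 'y) \<Rightarrow> bool" where
  "properly_discontinuous Y H \<psi> \<longleftrightarrow>
     (\<forall>K. compactin Y K \<longrightarrow> finite {g \<in> H. \<psi> g ` K \<inter> K \<noteq> {}})"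

definition cocompact :: "'y topology \<Rightarrow> 'g set \<Rightarrow> ('g \<Rightarrow> 'y \<Rightarrow> 'y) \<Rightarrow> bool" where
  "cocompact Y H \<psi> \<longleftrightarrow> (\<exists>K. compactin Y K \<and> (\<Union>g\<in>H. \<psi> g ` K) = topspace Y)"

definition n_discontinuous :: "nat \<Rightarrow> 'x topology \<Rightarrow> 'g set \<Rightarrow> ('g \<Rightarrow> 'x \<Rightarrow> 'x) \<Rightarrow> bool" where
  "n_discontinuous n X H \<phi> \<longleftrightarrow> properly_discontinuous (Theta n X) H (\<lambda>g S. \<phi> g ` S)"

definition n_cocompact :: "nat \<Rightarrow> 'x topology \<Rightarrow> 'g set \<Rightarrow> ('g \<Rightarrow> 'x \<Rightarrow> 'x) \<Rightarrow> bool" where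
  "n_cocompact n X H \<phi> \<longleftrightarrow> cocompact (Theta n X) H (\<lambda>g S. \<phi> g ` S)"

definition discontinuity_domain :: "'x topology \<Rightarrow> 'g set \<Rightarrow> ('g \<Rightarrow> 'x \<Rightarrow> 'x) \<Rightarrow> 'x set" where
  "discontinuity_domain X H \<phi> =
     {x. \<exists>U. openin X U \<and> x \<in> U \<and> finite {g \<in> H. \<phi> g ` U \<inter> U \<noteq> {}}}"

definition limit_set :: "'x topology \<Rightarrow> 'g set \<Rightarrow> ('g \<Rightarrow> 'x \<Rightarrow> 'x) \<Rightarrow> 'x set" where
  "limit_set X H \<phi> = topspace X - discontinuity_domain X H \<phi>"


section \<open>Free groups\<close>

text \<open>The letter \<open>(True, s)\<close> is the generator \<open>s\<close> and \<open>(False, s)\<close> is its formal inverse. The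
  elements of the free group are the freely reduced words; the product is the reduction of the
  concatenation.\<close>

fun push :: "bool \<times> 's \<Rightarrow> (bool \<times> 's) list \<Rightarrow> (bool \<times> 's) list" where
  "push a [] = [a]"
| "push a (b # w) = (if snd a = snd b \<and> fst a \<noteq> fst b then w else a # b # w)"

fun freely_reduced :: "(bool \<times> 's) list \<Rightarrow> bool" where
  "freely_reduced (a # b # w) \<longleftrightarrow> \<not> (snd a = snd b \<and> fst a \<noteq> fst b) \<and> freely_reduced (b # w)"
| "freely_reduced _ \<longleftrightarrow> True"

definition free_group :: "'s set \<Rightarrow> (bool \<times> 's) list monoid" where
  "free_group S = \<lparr>carrier = {w. freely_reduced w \<and> snd ` set w \<subseteq> S}, mult = foldr push, one = []\<rparr>"

lemma reduced_tl: "freely_reduced (a # w) \<Longrightarrow> freely_reduced w"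
  by (cases w) auto

lemma reduced_push: "freely_reduced w \<Longrightarrow> freely_reduced (push a w)"
  by (cases w) (auto dest: reduced_tl)

lemma reduced_foldr_push: "freely_reduced w \<Longrightarrow> freely_reduced (foldr push v w)"
  by (induction v) (auto simp: reduced_push)

lemma push_reduced: "freely_reduced (a # w) \<Longrightarrow> push a w = a # w"
  by (cases w) auto

lemma set_foldr_push: "set (foldr push v w) \<subseteq> set v \<union> set w"
proof (induction v)
  case (Cons a v)
  have "set (push a u) \<subseteq> insert a (set u)" for u
    by (cases u) auto
  with Cons show ?case
    by fastforce
qed auto

lemma push_push_inverse:
  assumes "freely_reduced w"
  shows "push (b, s) (push (\<not> b, s) w) = w"
proof (cases w)
  case (Cons c u)
  with assms show ?thesis
    by (cases u; cases c) (auto split: if_splits)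
qed auto

lemma foldr_push_push:
  assumes "freely_reduced w"
  shows "foldr push (push a v) w = push a (foldr push v w)"
proof (cases v)
  case (Cons c u)
  have "push a (push c (foldr push u w)) = foldr push u w"
    if "snd a = snd c" "fst a \<noteq> fst c"
    using that push_push_inverse[OF reduced_foldr_push[OF assms], of "fst a" "snd a" u]
    by (cases a; cases c) auto
  with Cons show ?thesis
    by auto
qed auto

lemma foldr_push_assoc:
  assumes "freely_reduced w"
  shows "foldr push (foldr push u v) w = foldr push u (foldr push v w)"
  by (induction u) (auto simp: foldr_push_push assms)

lemma foldr_push_Nil: "freely_reduced w \<Longrightarrow> foldr push w [] = w"
  proof (induction w)
  case (Cons a w)
  then show ?case
    using push_reduced[OF Cons.prems] reduced_tl[OF Cons.prems] by simp
qed auto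

lemma free_group_left_inverse:
  assumes "freely_reduced w"
  shows "\<exists>v. freely_reduced v \<and> snd ` set v \<subseteq> snd ` set w \<and> foldr push v w = []"
  using assms
proof (induction w)
  case (Cons a w)
  then obtain v where v: "freely_reduced v" "snd ` set v \<subseteq> snd ` set w" "foldr push v w = []"
    using reduced_tl by blast
  let ?b = "(\<not> fst a, snd a)"
  let ?v = "foldr push v [?b]"
  have "freely_reduced ?v"
    by (simp add: reduced_foldr_push)
  moreover have "snd ` set ?v \<subseteq> snd ` set (a # w)"
  proof -
    have "snd ` set ?v \<subseteq> snd ` (set v \<union> {?b})"
      using set_foldr_push[of v "[?b]"] by (intro image_mono) simp
    also have "\<dots> \<subseteq> snd ` set (a # w)"
      using v(2) by auto
    finally show ?thesis .
  qed
  moreover have "foldr push ?v (a # w) = []"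
    using foldr_push_assoc[OF Cons.prems, of v "[?b]"] v(3) by simp
  ultimately show ?case
    by blast
qed auto

lemma group_free_group: "group (free_group S)"
proof (rule groupI, goal_cases)
  case (1 u v)
  then have "snd ` set (foldr push u v) \<subseteq> S"
    using set_foldr_push[of u v] unfolding free_group_def by fastforce
  with 1 show ?case
    by (auto simp: free_group_def reduced_foldr_push)
next
  case (5 w)
  then show ?case
    using free_group_left_inverse[of w] by (fastforce simp: free_group_def)
qed (auto simp: free_group_def foldr_push_assoc)

definition free_eval :: "('a, 'm) monoid_scheme \<Rightarrow> ('s \<Rightarrow> 'a) \<Rightarrow> (bool \<times> 's) list \<Rightarrow> 'a" where
  "free_eval G f w =
     foldr (\<lambda>(b, s) x. (if b then f s else inv\<^bsub>G\<^esub> f s) \<otimes>\<^bsub>G\<^esub> x) w \<one>\<^bsub>G\<^esub>"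

lemma free_eval_hom:
  fixes G (structure)
  assumes "group G" and f: "\<And>s. s \<in> S \<Longrightarrow> f s \<in> carrier G"
  shows "free_eval G f \<in> hom (free_group S) G"
proof -
  interpret group G by fact
  have closed: "free_eval G f w \<in> carrier G" if "snd ` set w \<subseteq> S" for w
    using that by (induction w) (auto simp: free_eval_def f)
  have push: "free_eval G f (push (b, s) w) = (if b then f s else inv f s) \<otimes> free_eval G f w"
    if "s \<in> S" "snd ` set w \<subseteq> S" for b s w
  proof (cases w)
    case (Cons c u)
    with that show ?thesis
      using closed[of u] by (cases c) (auto simp: free_eval_def f m_assoc[symmetric])
  qed (auto simp: free_eval_def)
  have "free_eval G f (foldr push u v) = free_eval G f u \<otimes> free_eval G f v"
    if "snd ` set u \<subseteq> S" "snd ` set v \<subseteq> S" for u v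
    using that(1)
  proof (induction u)
    case Nil
    then show ?case
      using closed[OF that(2)] by (simp add: free_eval_def)
  next
    case (Cons a u)
    obtain b s where a: "a = (b, s)"
      by force
    have s: "s \<in> S" and u: "snd ` set u \<subseteq> S"
      using Cons.prems a by auto
    have uv: "snd ` set (foldr push u v) \<subseteq> S"
      using set_foldr_push[of u v] u that(2) by blast
    have "free_eval G f (a # u) = (if b then f s else inv f s) \<otimes> free_eval G f u"
      by (simp add: a free_eval_def)
    then show ?case
      using Cons.IH[OF u] push[OF s uv] closed[OF u] closed[OF that(2)] f[OF s]
      by (auto simp: a m_assoc)
  qed
  then show ?thesis
    using closed by (auto simp: hom_def free_group_def)
qed

lemma free_eval_generator:
  assumes "group G" and "f s \<in> carrier G"
  shows "free_eval G f [(True, s)] = f s"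
proof -
  interpret group G by fact
  show ?thesis
    using assms(2) by (simp add: free_eval_def)
qed


section \<open>Finitely presented groups\<close>

definition normal_closure :: "('a, 'm) monoid_scheme \<Rightarrow> 'a set \<Rightarrow> 'a set" where
  "normal_closure G R = \<Inter>{N. N \<lhd> G \<and> R \<subseteq> N}"

lemma normal_normal_closure:
  fixes G (structure)
  assumes "group G" and "R \<subseteq> carrier G"
  shows "normal_closure G R \<lhd> G"
proof -
  interpret group G by fact
  have carrier: "carrier G \<in> {N. N \<lhd> G \<and> R \<subseteq> N}"
    using assms(2) normal_inv_iff subgroup_self by simp
  then have "subgroup (normal_closure G R) G"
    unfolding normal_closure_def
    by (intro subgroups_Inter) (auto simp: normal_imp_subgroup)
  moreover have "x \<otimes> h \<otimes> inv x \<in> normal_closure G R"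
    if "x \<in> carrier G" "h \<in> normal_closure G R" for x h
    using that by (auto simp: normal_closure_def normal_inv_iff)
  ultimately show ?thesis
    by (simp add: normal_inv_iff)
qed

text \<open>As the generating set is finite, its elements may be taken to be natural numbers.\<close>

definition finitely_presented :: "('a, 'm) monoid_scheme \<Rightarrow> bool" where
  "finitely_presented G \<longleftrightarrow>
     (\<exists>(S :: nat set) R. finite S \<and> finite R \<and> R \<subseteq> carrier (free_group S) \<and>
        G \<cong> free_group S Mod normal_closure (free_group S) R)"

end

theory Submission
  imports Defs
begin

text \<open>
  The reason for the theorem is that \<open>H\<close> is a coarse Lipschitz retract of \<open>G\<close>, and that finite
  presentability passes to such retracts.

  Fix an isolated point \<open>a\<close> of \<open>A\<close>; its orbit is a copy of \<open>G\<close> inside \<open>X\<close> up to the finite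
  stabilizer, and a generator of \<open>G\<close> joins the points of the orbit by edges. Three facts about the
  dynamics matter. The edges become small in \<open>X\<close> (\<open>finite_edges_far_apart\<close>). The group \<open>H\<close> acts
  properly discontinuously on its discontinuity domain (\<open>finite_return_discontinuity_domain\<close>). By
  hypothesis, that domain is covered by the \<open>H\<close>-translates of a compact set \<open>K\<close>. Recording which
  translate of \<open>K\<close> contains a point of the orbit gives a map \<open>r\<close> from \<open>G\<close> to \<open>H\<close>. A small edge that
  begins in \<open>K\<close> ends in a compact neighbourhood of \<open>K\<close>, which meets only finitely many translates
  of \<open>K\<close>; so \<open>r\<close> changes by one of finitely many elements along the edges for a generator
  (\<open>coarse_retraction_exists\<close>). The first two facts follow from 3-discontinuity by the same
  device: since \<open>a\<close> is isolated, \<open>a\<close> and its image under \<open>g\<close> or \<open>inv g\<close> complete other points to a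
  triple that ranges over a compact set.

  Given \<open>r\<close>, a word over the generators of \<open>G\<close> is translated into a word over the finitely many
  increments of \<open>r\<close>, as in the Reidemeister--Schreier method. The translated relators of \<open>G\<close>, together
  with one relator for each increment, present \<open>H\<close> (\<open>finitely_presented_coarse_retract\<close>). In the
  Reidemeister--Schreier method the number of starting points of a relator is the index of \<open>H\<close>; here
  there may be infinitely many starting points, but they yield only finitely many words, because the
  increments are finite in number.\<close>

section \<open>Presentations as kernels of evaluation maps\<close>

lemma (in group) inv_cancel_left:
  assumes "x \<in> carrier G" "y \<in> carrier G"
  shows "x \<otimes> (inv x \<otimes> y) = y" "inv x \<otimes> (x \<otimes> y) = y"
  using assms by (simp_all add: m_assoc [symmetric])

lemma carrier_free_group_iff:
  "w \<in> carrier (free_group S) \<longleftrightarrow> freely_reduced w \<and> snd ` set w \<subseteq> S"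
  by (simp add: free_group_def)

lemma mult_free_group [simp]: "u \<otimes>\<^bsub>free_group S\<^esub> v = foldr push u v"
  by (simp add: free_group_def)

lemma one_free_group [simp]: "\<one>\<^bsub>free_group S\<^esub> = []"
  by (simp add: free_group_def)

lemma inv_generator_free_group:
  assumes "s \<in> S"
  shows "inv\<^bsub>free_group S\<^esub> [(True, s)] = [(False, s)]"
proof -
  interpret F: group "free_group S" by (rule group_free_group)
  show ?thesis
    using assms by (intro F.inv_equality) (auto simp: carrier_free_group_iff)
qed

text \<open>This is the induction principle for the free group: what holds for the generators and is closed
  under the group operations holds for all reduced words.\<close>

lemma free_group_subset_subgroup:
  assumes K: "subgroup K (free_group S)"
    and gen: "\<And>s. s \<in> S \<Longrightarrow> [(True, s)] \<in> K"
  shows "carrier (free_group S) \<subseteq> K"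
proof
  interpret K: subgroup K "free_group S" by fact
  interpret F: group "free_group S" by (rule group_free_group)
  fix w assume "w \<in> carrier (free_group S)"
  then show "w \<in> K"
  proof (induction w)
    case Nil
    show ?case
      using K.one_closed by simp
  next
    case (Cons a w)
    obtain b s where a: "a = (b, s)"
      by force
    have s: "s \<in> S" and w: "w \<in> carrier (free_group S)" and red: "freely_reduced (a # w)"
      using Cons.prems a by (auto simp: carrier_free_group_iff dest: reduced_tl)
    have "[a] \<in> K"
    proof (cases b)
      case False
      have "inv\<^bsub>free_group S\<^esub> [(True, s)] \<in> K"
        using gen[OF s] by (rule K.m_inv_closed)
      with False show ?thesis
        by (simp add: a inv_generator_free_group[OF s])
    qed (use gen[OF s] a in simp)
    then have "foldr push [a] w \<in> K"
      using K.m_closed[OF _ Cons.IH[OF w]] by fastforce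
    then show ?case
      by (simp add: push_reduced[OF red])
  qed
qed

lemma hom_free_group_eq_free_eval:
  assumes "group G" and p: "p \<in> hom (free_group S) G" and w: "w \<in> carrier (free_group S)"
  shows "p w = free_eval G (\<lambda>s. p [(True, s)]) w"
proof -
  interpret G: group G by fact
  let ?F = "free_group S" and ?e = "free_eval G (\<lambda>s. p [(True, s)])"
  interpret F: group ?F by (rule group_free_group)
  have gen: "p [(True, s)] \<in> carrier G" if "s \<in> S" for s
    using that p by (auto simp: hom_def carrier_free_group_iff)
  interpret p: group_hom ?F G p
    using p by (simp add: group_hom_def group_hom_axioms_def)
  interpret e: group_hom ?F G ?e
    using free_eval_hom[OF \<open>group G\<close> gen] by (simp add: group_hom_def group_hom_axioms_def)
  have "subgroup {v \<in> carrier ?F. p v = ?e v} ?F"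
    using p.hom_one e.hom_one F.one_closed by (intro F.subgroupI) (auto simp del: mult_free_group)
  moreover have "[(True, s)] \<in> {v \<in> carrier ?F. p v = ?e v}" if "s \<in> S" for s
    using that free_eval_generator[OF \<open>group G\<close>, of "\<lambda>s. p [(True, s)]", OF gen[OF that]]
    by (simp add: carrier_free_group_iff)
  ultimately have "carrier ?F \<subseteq> {v \<in> carrier ?F. p v = ?e v}"
    by (rule free_group_subset_subgroup)
  with w show ?thesis
    by blast
qed

text \<open>Working with a surjective evaluation map and its kernel, instead of an isomorphism to a quotient,
  makes it possible to construct and to use presentations with words and elements only.\<close>

proposition finitely_presented_iff_free_eval:
  assumes "group G"
  shows "finitely_presented G \<longleftrightarrow>
    (\<exists>(S :: nat set) f R. finite S \<and> finite R \<and> R \<subseteq> carrier (free_group S) \<and>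
       f ` S \<subseteq> carrier G \<and> free_eval G f ` carrier (free_group S) = carrier G \<and>
       kernel (free_group S) G (free_eval G f) = normal_closure (free_group S) R)"
    (is "_ \<longleftrightarrow> ?rhs")
proof
  interpret G: group G by fact
  assume "finitely_presented G"
  then obtain S :: "nat set" and R where fin: "finite S" "finite R"
    and R: "R \<subseteq> carrier (free_group S)"
    and iso: "G \<cong> free_group S Mod normal_closure (free_group S) R"
    unfolding finitely_presented_def by blast
  let ?F = "free_group S"
  let ?N = "normal_closure ?F R"
  interpret F: group ?F by (rule group_free_group)
  interpret N: normal ?N ?F
    using F.group_axioms R by (rule normal_normal_closure)
  obtain \<psi> where \<psi>: "\<psi> \<in> iso (?F Mod ?N) G"
    using G.iso_sym[OF iso] by (auto simp: is_iso_def)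
  define p where "p = \<psi> \<circ> (\<lambda>w. ?N #>\<^bsub>?F\<^esub> w)"
  interpret Q: group_hom "?F Mod ?N" G \<psi>
    using \<psi> N.factorgroup_is_group by (simp add: group_hom_def group_hom_axioms_def iso_def)
  have p: "p \<in> hom ?F G"
    unfolding p_def using N.r_coset_hom_Mod \<psi> by (intro hom_compose) (auto simp: iso_def)
  have surj: "p ` carrier ?F = carrier G"
    using \<psi> unfolding p_def image_comp [symmetric] carrier_FactGroup [symmetric]
    by (simp add: iso_def bij_betw_def)
  have ker: "p w = \<one>\<^bsub>G\<^esub> \<longleftrightarrow> w \<in> ?N" if w: "w \<in> carrier ?F" for w
  proof -
    have "p w = \<one>\<^bsub>G\<^esub> \<longleftrightarrow> ?N #>\<^bsub>?F\<^esub> w = ?N"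
      using \<psi> w Q.iso_iff Q.hom_one by (auto simp: p_def carrier_FactGroup)
    also have "\<dots> \<longleftrightarrow> w \<in> ?N"
      using F.coset_join1 F.coset_join2 w N.subgroup_axioms by blast
    finally show ?thesis .
  qed
  have eval: "free_eval G (\<lambda>s. p [(True, s)]) w = p w" if "w \<in> carrier ?F" for w
    using hom_free_group_eq_free_eval[OF assms p that] by simp
  have "p [(True, s)] \<in> carrier G" if "s \<in> S" for s
    using that p by (auto simp: hom_def carrier_free_group_iff)
  moreover have "free_eval G (\<lambda>s. p [(True, s)]) ` carrier ?F = carrier G"
    using surj eval by (metis (no_types, lifting) image_cong)
  moreover have "kernel ?F G (free_eval G (\<lambda>s. p [(True, s)])) = ?N"
    using eval ker N.subset by (auto simp: kernel_def)
  ultimately show ?rhs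
    using fin R by (intro exI[of _ S] exI[of _ "\<lambda>s. p [(True, s)]"] exI[of _ R]) auto
next
  assume ?rhs
  then obtain S :: "nat set" and f R where fin: "finite S" "finite R"
    and R: "R \<subseteq> carrier (free_group S)" and f: "f ` S \<subseteq> carrier G"
    and surj: "free_eval G f ` carrier (free_group S) = carrier G"
    and ker: "kernel (free_group S) G (free_eval G f) = normal_closure (free_group S) R"
    by blast
  interpret p: group_hom "free_group S" G "free_eval G f"
    using free_eval_hom[OF assms, of S f] f assms group_free_group[of S]
    by (auto simp: group_hom_def group_hom_axioms_def)
  interpret K: normal "kernel (free_group S) G (free_eval G f)" "free_group S"
    by (rule p.normal_kernel)
  have "G \<cong> free_group S Mod kernel (free_group S) G (free_eval G f)"
    by (rule group.iso_sym[OF K.factorgroup_is_group p.FactGroup_iso[OF surj]])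
  then show "finitely_presented G"
    unfolding finitely_presented_def using fin R ker by auto
qed

section \<open>Cocycles on a free group\<close>

text \<open>
  Let the free group on \<open>S\<close> act on \<open>G\<close> by left translations through \<open>f\<close>. A function \<open>y\<close> attaches an
  element of \<open>M\<close> to each edge \<open>g \<rightarrow> f s \<otimes> g\<close> of the Cayley graph. Reading a word from right to left
  as a path that starts at \<open>g\<close>, and multiplying the labels of its edges (inverted when the edge is
  traversed backwards), extends \<open>y\<close> to a cocycle. Such a cocycle is the same as a lift of the
  homomorphism from the free group to \<open>G\<close> to the semidirect product of the functions from \<open>G\<close> to \<open>M\<close>
  with \<open>G\<close>.\<close>

locale free_group_cocycle = G: group G + M: group M
  for G :: "('g, 'm) monoid_scheme" (structure) and M :: "('b, 'n) monoid_scheme" +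
  fixes S :: "'s set" and f :: "'s \<Rightarrow> 'g" and y :: "'s \<Rightarrow> 'g \<Rightarrow> 'b"
  assumes f_closed [simp]: "s \<in> S \<Longrightarrow> f s \<in> carrier G"
    and y_closed [simp]: "s \<in> S \<Longrightarrow> g \<in> carrier G \<Longrightarrow> y s g \<in> carrier M"
begin

abbreviation eval :: "(bool \<times> 's) list \<Rightarrow> 'g" where
  "eval \<equiv> free_eval G f"

text \<open>The inverse letter of \<open>s\<close> leads from \<open>g\<close> to \<open>inv f s \<otimes> g\<close>, which is where the edge labelled
  by \<open>s\<close> that it traverses backwards begins.\<close>

fun letter :: "bool \<times> 's \<Rightarrow> 'g \<Rightarrow> 'b" where
  "letter (True, s) g = y s g"
| "letter (False, s) g = inv\<^bsub>M\<^esub> y s (inv f s \<otimes> g)"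

fun cocycle :: "(bool \<times> 's) list \<Rightarrow> 'g \<Rightarrow> 'b" where
  "cocycle [] g = \<one>\<^bsub>M\<^esub>"
| "cocycle (a # w) g = letter a (eval w \<otimes> g) \<otimes>\<^bsub>M\<^esub> cocycle w g"

lemma eval_Nil [simp]: "eval [] = \<one>"
  by (simp add: free_eval_def)

lemma eval_Cons [simp]: "eval ((b, s) # w) = (if b then f s else inv f s) \<otimes> eval w"
  by (simp add: free_eval_def)

lemma eval_closed [simp]: "snd ` set w \<subseteq> S \<Longrightarrow> eval w \<in> carrier G"
  by (induction w) (auto simp: free_eval_def)

sublocale eval: group_hom "free_group S" G eval
  using free_eval_hom[OF G.group_axioms, of S f] group_free_group
  by (simp add: group_hom_def group_hom_axioms_def G.group_axioms)

lemma letter_closed [simp]: "snd a \<in> S \<Longrightarrow> g \<in> carrier G \<Longrightarrow> letter a g \<in> carrier M"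
  by (cases a; cases "fst a") auto

lemma cocycle_closed [simp]: "snd ` set w \<subseteq> S \<Longrightarrow> g \<in> carrier G \<Longrightarrow> cocycle w g \<in> carrier M"
  by (induction w) auto

lemma letter_cancel:
  assumes "s \<in> S" "g \<in> carrier G"
  shows "letter (\<not> b, s) ((if b then f s else inv f s) \<otimes> g) \<otimes>\<^bsub>M\<^esub> letter (b, s) g = \<one>\<^bsub>M\<^esub>"
  using assms by (cases b) (simp_all add: G.m_assoc [symmetric])

lemma cocycle_push:
  assumes "snd a \<in> S" "snd ` set w \<subseteq> S" "g \<in> carrier G"
  shows "cocycle (push a w) g = cocycle (a # w) g"
proof (cases "\<exists>u. w = (\<not> fst a, snd a) # u")
  case True
  then obtain u where w: "w = (\<not> fst a, snd a) # u"
    by blast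
  obtain b s where a: "a = (\<not> b, s)"
    using that[of "\<not> fst a" "snd a"] by simp
  have u: "snd ` set u \<subseteq> S" and s: "s \<in> S"
    using assms w a by auto
  have "letter (\<not> b, s) (eval w \<otimes> g) \<otimes>\<^bsub>M\<^esub> letter (b, s) (eval u \<otimes> g) = \<one>\<^bsub>M\<^esub>"
    using letter_cancel[OF s, of "eval u \<otimes> g" b] u s assms(3) by (simp add: w a G.m_assoc)
  then show ?thesis
    using u s assms(3) by (simp add: w a M.m_assoc [symmetric])
next
  case False
  then have "push a w = a # w"
    by (cases w) (auto simp: prod_eq_iff)
  then show ?thesis
    by simp
qed

lemma cocycle_mult:
  assumes "u \<in> carrier (free_group S)" "v \<in> carrier (free_group S)" "g \<in> carrier G"
  shows "cocycle (foldr push u v) g = cocycle u (eval v \<otimes> g) \<otimes>\<^bsub>M\<^esub> cocycle v g"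
  using assms(1)
proof (induction u)
  case Nil
  then show ?case
    using assms by (simp add: carrier_free_group_iff)
next
  case (Cons a u)
  have u: "u \<in> carrier (free_group S)" and a: "snd a \<in> S"
    using Cons.prems by (auto simp: carrier_free_group_iff dest: reduced_tl)
  have letters: "snd ` set u \<subseteq> S" "snd ` set v \<subseteq> S" "snd ` set (foldr push u v) \<subseteq> S"
    using u assms(2) eval.G.m_closed[OF u assms(2)] by (auto simp: carrier_free_group_iff)
  have "eval (foldr push u v) = eval u \<otimes> eval v"
    using eval.hom_mult[OF u assms(2)] by simp
  then show ?case
    using Cons.IH[OF u] cocycle_push[OF a letters(3) assms(3)] letters a assms(3)
    by (simp add: M.m_assoc G.m_assoc)
qed

lemma cocycle_inv:
  assumes w: "w \<in> carrier (free_group S)" and g: "g \<in> carrier G"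
  shows "cocycle (inv\<^bsub>free_group S\<^esub> w) (eval w \<otimes> g) = inv\<^bsub>M\<^esub> cocycle w g"
proof -
  let ?v = "inv\<^bsub>free_group S\<^esub> w"
  have v: "?v \<in> carrier (free_group S)"
    using w by simp
  have "foldr push ?v w = []"
    using eval.G.l_inv[OF w] by simp
  then have "cocycle ?v (eval w \<otimes> g) \<otimes>\<^bsub>M\<^esub> cocycle w g = \<one>\<^bsub>M\<^esub>"
    using cocycle_mult[OF v w g] by simp
  then show ?thesis
    using v w g by (intro M.inv_equality [symmetric]) (auto simp: carrier_free_group_iff)
qed

text \<open>The words that act trivially on \<open>G\<close> and have all their cocycle values in a given normal subgroup
  form a normal subgroup of the free group. So it suffices to check the relators, but at every base
  point \<open>g\<close>: conjugating a relator moves the base point.\<close>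

lemma cocycle_in_normal_subgroup:
  assumes N: "N \<lhd> M" and R: "R \<subseteq> carrier (free_group S)"
    and rel: "\<And>\<rho> g. \<rho> \<in> R \<Longrightarrow> g \<in> carrier G \<Longrightarrow> cocycle \<rho> g \<in> N"
    and eval1: "\<And>\<rho>. \<rho> \<in> R \<Longrightarrow> eval \<rho> = \<one>"
    and w: "w \<in> normal_closure (free_group S) R" and g: "g \<in> carrier G"
  shows "cocycle w g \<in> N"
proof -
  let ?F = "free_group S"
  let ?L = "{w \<in> carrier ?F. eval w = \<one> \<and> (\<forall>g\<in>carrier G. cocycle w g \<in> N)}"
  interpret N: normal N M by fact
  have letters: "v \<in> carrier ?F \<Longrightarrow> snd ` set v \<subseteq> S" for v
    by (simp add: carrier_free_group_iff)
  have mult: "cocycle (u \<otimes>\<^bsub>?F\<^esub> v) g = cocycle u (eval v \<otimes> g) \<otimes>\<^bsub>M\<^esub> cocycle v g"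
    if "u \<in> carrier ?F" "v \<in> carrier ?F" "g \<in> carrier G" for u v g
    using cocycle_mult[OF that] by simp
  have "?L \<lhd> ?F"
  proof (rule eval.G.normal_invI)
    show "subgroup ?L ?F"
    proof (rule eval.G.subgroupI)
      have "[] \<in> ?L"
        using eval.G.one_closed by (simp add: N.one_closed)
      then show "?L \<noteq> {}"
        by blast
    next
      fix u assume u: "u \<in> ?L"
      have "cocycle (inv\<^bsub>?F\<^esub> u) g \<in> N" if "g \<in> carrier G" for g
        using cocycle_inv[of u g] u that N.m_inv_closed by simp
      with u show "inv\<^bsub>?F\<^esub> u \<in> ?L"
        by simp
    next
      fix u v assume "u \<in> ?L" "v \<in> ?L"
      then show "u \<otimes>\<^bsub>?F\<^esub> v \<in> ?L"
        using mult[of u v] eval.hom_mult[of u v] eval.G.m_closed[of u v]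
        by (simp del: mult_free_group add: N.m_closed)
    qed auto
  next
    fix x u assume x: "x \<in> carrier ?F" and u: "u \<in> ?L"
    let ?x' = "inv\<^bsub>?F\<^esub> x"
    have "cocycle (x \<otimes>\<^bsub>?F\<^esub> u \<otimes>\<^bsub>?F\<^esub> ?x') g \<in> N" if g: "g \<in> carrier G" for g
    proof -
      define g' where "g' = eval ?x' \<otimes> g"
      have g': "g' \<in> carrier G" "eval x \<otimes> g' = g"
        using x g eval.hom_closed[OF x] by (simp_all add: g'_def G.m_assoc [symmetric])
      have x': "cocycle ?x' g = inv\<^bsub>M\<^esub> cocycle x g'"
        using cocycle_inv[OF x g'(1)] g'(2) by simp
      have "cocycle (x \<otimes>\<^bsub>?F\<^esub> u \<otimes>\<^bsub>?F\<^esub> ?x') g = cocycle (x \<otimes>\<^bsub>?F\<^esub> u) g' \<otimes>\<^bsub>M\<^esub> cocycle ?x' g"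
        unfolding g'_def using x u g by (intro mult) (auto simp del: mult_free_group)
      also have "cocycle (x \<otimes>\<^bsub>?F\<^esub> u) g' = cocycle x g' \<otimes>\<^bsub>M\<^esub> cocycle u g'"
        using mult[OF x _ g'(1), of u] u g' by simp
      finally show ?thesis
        unfolding x' using u g' letters[OF x] by (simp add: N.inv_op_closed2)
    qed
    then show "x \<otimes>\<^bsub>?F\<^esub> u \<otimes>\<^bsub>?F\<^esub> ?x' \<in> ?L"
      using x u eval.hom_mult[of "x \<otimes>\<^bsub>?F\<^esub> u" ?x'] eval.hom_mult[of x u]
      by (simp del: mult_free_group)
  qed
  moreover have "R \<subseteq> ?L"
    using R rel eval1 by auto
  ultimately show ?thesis
    using w g by (auto simp: normal_closure_def)
qed

text \<open>This is where finitely many labels for each generator give, for a relator, finitely many relators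
  as the base point varies over the possibly infinite group.\<close>

lemma finite_cocycle_values:
  assumes fin: "\<And>s. s \<in> S \<Longrightarrow> finite (y s ` carrier G)" and w: "snd ` set w \<subseteq> S"
  shows "finite (cocycle w ` carrier G)"
  using w
proof (induction w)
  case Nil
  have "cocycle [] ` carrier G \<subseteq> {\<one>\<^bsub>M\<^esub>}"
    by auto
  then show ?case
    by (rule finite_subset) simp
next
  case (Cons a w)
  obtain b s where a: "a = (b, s)"
    by force
  have s: "s \<in> S" and w: "snd ` set w \<subseteq> S"
    using Cons.prems a by auto
  let ?Y = "y s ` carrier G"
  have "letter a g \<in> ?Y \<union> m_inv M ` ?Y" if "g \<in> carrier G" for g
    using that s by (cases b) (auto simp: a)
  then have "(letter a (eval w \<otimes> g), cocycle w g) \<in> (?Y \<union> m_inv M ` ?Y) \<times> cocycle w ` carrier G"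
    if "g \<in> carrier G" for g
    using that w by auto
  then have "cocycle (a # w) ` carrier G
      \<subseteq> (\<lambda>(l, c). l \<otimes>\<^bsub>M\<^esub> c) ` ((?Y \<union> m_inv M ` ?Y) \<times> cocycle w ` carrier G)"
    by (intro image_subsetI) (metis (no_types, lifting) case_prod_conv cocycle.simps(2) image_eqI)
  then show ?case
    by (rule finite_subset) (use fin[OF s] Cons.IH[OF w] in simp)
qed

lemma cocycle_right_invariant:
  assumes inv: "\<And>s g. s \<in> S \<Longrightarrow> g \<in> carrier G \<Longrightarrow> y s (g \<otimes> h) = y s g"
    and h: "h \<in> carrier G" and w: "snd ` set w \<subseteq> S" and g: "g \<in> carrier G"
  shows "cocycle w (g \<otimes> h) = cocycle w g"
  using w
proof (induction w)
  case (Cons a w)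
  obtain b s where a: "a = (b, s)"
    by force
  have s: "s \<in> S" and w: "snd ` set w \<subseteq> S"
    using Cons.prems a by auto
  have "letter a (x \<otimes> h) = letter a x" if "x \<in> carrier G" for x
    using that s h inv[of s x] inv[of s "inv f s \<otimes> x"]
    by (cases b) (auto simp: a G.m_assoc)
  then show ?case
    using Cons.IH[OF w] w g h by (simp add: G.m_assoc [symmetric])
qed simp

text \<open>If the labels are mapped to the differences of a function \<open>r\<close> along the edges, the product along a
  path telescopes.\<close>

lemma hom_cocycle_coboundary:
  assumes "group K" and \<pi>: "\<pi> \<in> hom M K"
    and r: "\<And>g. g \<in> carrier G \<Longrightarrow> r g \<in> carrier K"
    and y: "\<And>s g. s \<in> S \<Longrightarrow> g \<in> carrier G \<Longrightarrow> \<pi> (y s g) = r (f s \<otimes> g) \<otimes>\<^bsub>K\<^esub> inv\<^bsub>K\<^esub> r g"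
    and w: "snd ` set w \<subseteq> S" and g: "g \<in> carrier G"
  shows "\<pi> (cocycle w g) = r (eval w \<otimes> g) \<otimes>\<^bsub>K\<^esub> inv\<^bsub>K\<^esub> r g"
proof -
  interpret K: group K by fact
  interpret \<pi>: group_hom M K \<pi>
    using \<pi> by (simp add: group_hom_def group_hom_axioms_def M.group_axioms \<open>group K\<close>)
  show ?thesis
    using w
  proof (induction w)
    case Nil
    then show ?case
      using g r by simp
  next
    case (Cons a w)
    obtain b s where a: "a = (b, s)"
      by force
    have s: "s \<in> S" and w: "snd ` set w \<subseteq> S"
      using Cons.prems a by auto
    define x where "x = eval w \<otimes> g"
    have x: "x \<in> carrier G"
      using w g by (simp add: x_def)
    define e where "e = (if b then f s else inv f s)"
    have e: "e \<in> carrier G"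
      using s by (simp add: e_def)
    have "\<pi> (letter a x) = r (e \<otimes> x) \<otimes>\<^bsub>K\<^esub> inv\<^bsub>K\<^esub> r x"
    proof (cases b)
      case True
      then show ?thesis
        using y[OF s x] by (simp add: a e_def)
    next
      case False
      then have "\<pi> (letter a x) = inv\<^bsub>K\<^esub> (r (f s \<otimes> (inv f s \<otimes> x)) \<otimes>\<^bsub>K\<^esub> inv\<^bsub>K\<^esub> r (inv f s \<otimes> x))"
        using s x y[of s "inv f s \<otimes> x"] by (simp add: a)
      then show ?thesis
        using False s x r by (simp add: e_def G.m_assoc [symmetric] K.inv_mult_group)
    qed
    moreover have "\<pi> (cocycle w g) = r x \<otimes>\<^bsub>K\<^esub> inv\<^bsub>K\<^esub> r g"
      using Cons.IH[OF w] by (simp add: x_def)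
    moreover have "eval (a # w) \<otimes> g = e \<otimes> x"
      using w g e by (simp add: a e_def x_def G.m_assoc s)
    moreover have "\<pi> (cocycle (a # w) g) = \<pi> (letter a x) \<otimes>\<^bsub>K\<^esub> \<pi> (cocycle w g)"
      using w g s x by (simp add: x_def a)
    moreover have "(r (e \<otimes> x) \<otimes>\<^bsub>K\<^esub> inv\<^bsub>K\<^esub> r x) \<otimes>\<^bsub>K\<^esub> (r x \<otimes>\<^bsub>K\<^esub> inv\<^bsub>K\<^esub> r g) = r (e \<otimes> x) \<otimes>\<^bsub>K\<^esub> inv\<^bsub>K\<^esub> r g"
      using r[OF x] r[OF g] r[of "e \<otimes> x"] e x
      by (metis G.m_closed K.inv_closed K.l_inv K.l_one K.m_assoc K.m_closed)
    ultimately show ?case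
      by simp
  qed
qed

end

section \<open>Finite presentability passes to coarse retracts\<close>

text \<open>
  The hypotheses say that \<open>r\<close> is an \<open>H\<close>-equivariant retraction of \<open>G\<close> onto \<open>H\<close> which is coarsely
  Lipschitz: moving along an edge of the Cayley graph changes the value of \<open>r\<close> by one of finitely
  many elements. Those finitely many elements \<open>D\<close> serve as generators of \<open>H\<close>, and \<open>r\<close> translates
  words for \<open>G\<close> into words for \<open>H\<close>, by the cocycle whose labels are the generators that name the
  differences of \<open>r\<close>. The relators for \<open>H\<close> are the translations of the relators of \<open>G\<close> from all
  starting points, which are finitely many words, and for each generator \<open>d\<close> a relation that identifies
  it with the translation of some word for \<open>d\<close> over the generators of \<open>G\<close>.

  These suffice: modulo the translated relators the translation of a word depends only on the element
  of \<open>G\<close> that it represents, and by equivariance translation is multiplicative on \<open>H\<close>. By the second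
  kind of relation it then is inverse to evaluation.\<close>

proposition finitely_presented_coarse_retract:
  fixes G (structure)
  assumes "group G" and "subgroup H G"
    and r_closed: "\<And>g. g \<in> carrier G \<Longrightarrow> r g \<in> H"
    and r_mult: "\<And>g h. g \<in> carrier G \<Longrightarrow> h \<in> H \<Longrightarrow> r (g \<otimes> h) = r g \<otimes> h"
    and r_one: "r \<one> = \<one>"
    and displacement: "\<And>s. s \<in> carrier G \<Longrightarrow> finite ((\<lambda>g. r (s \<otimes> g) \<otimes> inv r g) ` carrier G)"
    and "finitely_presented G"
  shows "finitely_presented (G\<lparr>carrier := H\<rparr>)"
proof -
  \<comment> \<open>Products of words stay symbolic, so that the group laws apply to them.\<close>
  note [simp del] = mult_free_group one_free_group
  interpret G: group G by fact
  interpret H: subgroup H G by fact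
  let ?K = "G\<lparr>carrier := H\<rparr>"
  interpret K: group ?K
    by (rule H.subgroup_is_group[OF G.group_axioms])
  obtain S :: "nat set" and f R where fin: "finite S" "finite R"
    and R: "R \<subseteq> carrier (free_group S)" and f: "f ` S \<subseteq> carrier G"
    and surj: "free_eval G f ` carrier (free_group S) = carrier G"
    and ker: "kernel (free_group S) G (free_eval G f) = normal_closure (free_group S) R"
    using \<open>finitely_presented G\<close> finitely_presented_iff_free_eval[OF \<open>group G\<close>] by metis
  define d where "d s g = r (f s \<otimes> g) \<otimes> inv r g" for s g
  define D where "D = (\<Union>s\<in>S. d s ` carrier G)"
  have f_closed: "f s \<in> carrier G" if "s \<in> S" for s
    using f that by blast
  have D: "finite D" "D \<subseteq> H"
    using fin(1) displacement f_closed r_closed by (auto simp: D_def d_def)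
  define T where "T = {..<card D}"
  obtain e where e: "bij_betw e T D"
    unfolding T_def using ex_bij_betw_nat_finite[OF D(1)] atLeast0LessThan by metis
  define y where "y s g = [(True, inv_into T e (d s g))]" for s g
  let ?M = "free_group T"
  have y: "y s g \<in> carrier ?M" "e (inv_into T e (d s g)) = d s g"
    if "s \<in> S" "g \<in> carrier G" for s g
  proof -
    have "d s g \<in> e ` T"
      using that e by (auto simp: D_def bij_betw_def)
    then show "y s g \<in> carrier ?M" "e (inv_into T e (d s g)) = d s g"
      by (auto simp: y_def carrier_free_group_iff inv_into_into f_inv_into_f)
  qed
  interpret M: group ?M by (rule group_free_group)
  interpret C: free_group_cocycle G ?M S f y
    by (intro free_group_cocycle.intro free_group_cocycle_axioms.intro)
      (use f_closed y group_free_group G.group_axioms in auto)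
  let ?\<pi> = "free_eval ?K e"
  have e_closed: "e t \<in> H" if "t \<in> T" for t
    using that e D(2) by (auto simp: bij_betw_def)
  interpret \<pi>: group_hom ?M ?K ?\<pi>
    using free_eval_hom[OF K.group_axioms, of T e] e_closed
    by (simp add: group_hom_def group_hom_axioms_def K.group_axioms group_free_group)
  have r_id: "r h = h" if "h \<in> H" for h
    using r_mult[of \<one> h] that r_one by simp
  have \<pi>_generator: "?\<pi> [(True, t)] = e t" if "t \<in> T" for t
    using free_eval_generator[OF K.group_axioms, of e t] e_closed[OF that] by simp
  have \<pi>_y: "?\<pi> (y s g) = r (f s \<otimes> g) \<otimes>\<^bsub>?K\<^esub> inv\<^bsub>?K\<^esub> r g" if "s \<in> S" "g \<in> carrier G" for s g
  proof -
    have "inv_into T e (d s g) \<in> T"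
      using y(1)[OF that] by (simp add: y_def carrier_free_group_iff)
    then show ?thesis
      using that y(2)[OF that] \<pi>_generator r_closed \<open>subgroup H G\<close> by (simp add: y_def d_def)
  qed
  have letters: "snd ` set w \<subseteq> S" if "w \<in> carrier (free_group S)" for w
    using that by (simp add: carrier_free_group_iff)
  have \<pi>_cocycle: "?\<pi> (C.cocycle w g) = r (C.eval w \<otimes> g) \<otimes> inv r g"
    if "w \<in> carrier (free_group S)" "g \<in> carrier G" for w g
    using C.hom_cocycle_coboundary[OF K.group_axioms \<pi>.homh _ \<pi>_y letters[OF that(1)] that(2)] that(2)
      r_closed \<open>subgroup H G\<close> by simp
  have d_invariant: "d s (g \<otimes> h) = d s g" if "s \<in> S" "g \<in> carrier G" "h \<in> H" for s g h
    using that f_closed r_closed H.mem_carrier r_mult[of "f s \<otimes> g" h]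
    by (simp add: d_def r_mult G.m_assoc [symmetric] G.inv_mult_group)
       (simp add: G.m_assoc)
  have cocycle_invariant: "C.cocycle w h = C.cocycle w \<one>" if "w \<in> carrier (free_group S)" "h \<in> H" for w h
    using C.cocycle_right_invariant[of h w \<one>] letters that d_invariant
    by (simp add: y_def)
  have lift: "\<exists>w. w \<in> carrier (free_group S) \<and> C.eval w = g" if "g \<in> carrier G" for g
    using surj that by (metis imageE)
  then have "\<exists>w. \<forall>t\<in>T. w t \<in> carrier (free_group S) \<and> C.eval (w t) = e t"
    using e_closed by (intro bchoice) auto
  then obtain w where w: "\<And>t. t \<in> T \<Longrightarrow> w t \<in> carrier (free_group S)"
    and eval_w: "\<And>t. t \<in> T \<Longrightarrow> C.eval (w t) = e t"
    by blast
  define R' where "R' = (\<Union>\<rho>\<in>R. C.cocycle \<rho> ` carrier G) \<union>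
    (\<lambda>t. C.cocycle (w t) \<one> \<otimes>\<^bsub>?M\<^esub> inv\<^bsub>?M\<^esub> [(True, t)]) ` T"
  have gen: "[(True, t)] \<in> carrier ?M" if "t \<in> T" for t
    using that by (simp add: carrier_free_group_iff)
  have cocycle_closed: "C.cocycle v g \<in> carrier ?M" if "v \<in> carrier (free_group S)" "g \<in> carrier G" for v g
    using that letters by simp
  have "finite R'"
  proof -
    have "finite (y s ` carrier G)" if "s \<in> S" for s
    proof -
      have "finite ((\<lambda>c. [(True, inv_into T e c)]) ` d s ` carrier G)"
        using displacement[OF f_closed[OF that]] by (simp add: d_def)
      then show ?thesis
        by (simp add: image_image y_def)
    qed
    then have "finite (C.cocycle \<rho> ` carrier G)" if "\<rho> \<in> R" for \<rho>
      using R that letters[of \<rho>] by (intro C.finite_cocycle_values) blast+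
    then show ?thesis
      using fin(2) by (simp add: R'_def T_def)
  qed
  have R'_closed: "R' \<subseteq> carrier ?M"
    using R w gen cocycle_closed unfolding R'_def by (auto simp del: C.cocycle.simps)
  let ?N = "normal_closure ?M R'"
  interpret N: normal ?N ?M
    using group_free_group R'_closed by (rule normal_normal_closure)
  have R'_subset: "R' \<subseteq> ?N"
    by (auto simp: normal_closure_def)
  have eval_R: "C.eval \<rho> = \<one>" if "\<rho> \<in> R" for \<rho>
  proof -
    have "\<rho> \<in> normal_closure (free_group S) R"
      using that by (auto simp: normal_closure_def)
    then show ?thesis
      by (simp add: ker [symmetric] kernel_def)
  qed
  have R'_kernel: "R' \<subseteq> kernel ?M ?K ?\<pi>"
  proof -
    have "?\<pi> (C.cocycle \<rho> g) = \<one>" if "\<rho> \<in> R" "g \<in> carrier G" for \<rho> g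
      using \<pi>_cocycle[of \<rho> g] that R eval_R r_closed H.mem_carrier by auto
    moreover have "?\<pi> (C.cocycle (w t) \<one> \<otimes>\<^bsub>?M\<^esub> inv\<^bsub>?M\<^esub> [(True, t)]) = \<one>" if t: "t \<in> T" for t
    proof -
      have "?\<pi> (C.cocycle (w t) \<one>) = e t"
        using \<pi>_cocycle[OF w[OF t] G.one_closed] eval_w[OF t] e_closed[OF t] r_one r_id by simp
      then have "?\<pi> (C.cocycle (w t) \<one> \<otimes>\<^bsub>?M\<^esub> inv\<^bsub>?M\<^esub> [(True, t)]) = e t \<otimes> inv e t"
        using \<pi>.hom_mult[OF cocycle_closed[OF w[OF t] G.one_closed] M.inv_closed[OF gen[OF t]]]
          gen[OF t] \<pi>_generator[OF t] e_closed[OF t] \<open>subgroup H G\<close> by simp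
      then show ?thesis
        using e_closed[OF t] by simp
    qed
    ultimately have "?\<pi> x = \<one>" if "x \<in> R'" for x
      using that unfolding R'_def by blast
    then show ?thesis
      using R'_closed by (auto simp: kernel_def)
  qed
  then have N_kernel: "?N \<subseteq> kernel ?M ?K ?\<pi>"
    using \<pi>.normal_kernel by (auto simp: normal_closure_def)
  have cocycle_R: "C.cocycle \<rho> g \<in> ?N" if "\<rho> \<in> R" "g \<in> carrier G" for \<rho> g
    using that R'_subset unfolding R'_def by blast
  \<comment> \<open>The elements on which translating after evaluating is the identity modulo the relators.\<close>
  let ?L = "{v \<in> carrier ?M. \<exists>u \<in> carrier (free_group S).
    C.eval u = ?\<pi> v \<and> C.cocycle u \<one> \<otimes>\<^bsub>?M\<^esub> inv\<^bsub>?M\<^esub> v \<in> ?N}"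
  have "subgroup ?L ?M"
  proof (rule M.subgroupI)
    have "C.cocycle \<one>\<^bsub>free_group S\<^esub> \<one> = \<one>\<^bsub>?M\<^esub>"
      by (simp add: one_free_group)
    then have "\<one>\<^bsub>?M\<^esub> \<in> ?L"
      using C.eval.hom_one \<pi>.hom_one by (auto intro!: bexI[of _ "\<one>\<^bsub>free_group S\<^esub>"])
    then show "?L \<noteq> {}"
      by blast
  next
    fix v assume "v \<in> ?L"
    then obtain u where v: "v \<in> carrier ?M" and u: "u \<in> carrier (free_group S)"
      and uv: "C.eval u = ?\<pi> v" and N: "C.cocycle u \<one> \<otimes>\<^bsub>?M\<^esub> inv\<^bsub>?M\<^esub> v \<in> ?N"
      by blast
    let ?u' = "inv\<^bsub>free_group S\<^esub> u" and ?c = "C.cocycle u \<one>"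
    have u': "?u' \<in> carrier (free_group S)"
      using u by simp
    have \<pi>v: "?\<pi> v \<in> H"
      using \<pi>.hom_closed[OF v] by simp
    have c: "?c \<in> carrier ?M"
      using cocycle_closed[OF u] by simp
    have "C.cocycle ?u' \<one> = inv\<^bsub>?M\<^esub> ?c"
      using C.cocycle_inv[OF u G.one_closed] cocycle_invariant[OF u' \<pi>v] \<pi>v uv by simp
    moreover have "inv\<^bsub>?M\<^esub> ?c \<otimes>\<^bsub>?M\<^esub> inv\<^bsub>?M\<^esub> (inv\<^bsub>?M\<^esub> v) \<in> ?N"
      using N.inv_op_closed1[OF c N.m_inv_closed[OF N]] c v
      by (simp add: M.inv_mult_group M.m_assoc)
    moreover have "C.eval ?u' = ?\<pi> (inv\<^bsub>?M\<^esub> v)"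
      using u v uv \<pi>v \<open>subgroup H G\<close> by simp
    ultimately show "inv\<^bsub>?M\<^esub> v \<in> ?L"
      using u' v by auto
  next
    fix v1 v2 assume "v1 \<in> ?L" "v2 \<in> ?L"
    then obtain u1 u2 where v: "v1 \<in> carrier ?M" "v2 \<in> carrier ?M"
      and u: "u1 \<in> carrier (free_group S)" "u2 \<in> carrier (free_group S)"
      and uv: "C.eval u1 = ?\<pi> v1" "C.eval u2 = ?\<pi> v2"
      and N: "C.cocycle u1 \<one> \<otimes>\<^bsub>?M\<^esub> inv\<^bsub>?M\<^esub> v1 \<in> ?N" "C.cocycle u2 \<one> \<otimes>\<^bsub>?M\<^esub> inv\<^bsub>?M\<^esub> v2 \<in> ?N"
      by blast
    let ?c1 = "C.cocycle u1 \<one>" and ?c2 = "C.cocycle u2 \<one>" and ?u = "u1 \<otimes>\<^bsub>free_group S\<^esub> u2"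
    have c: "?c1 \<in> carrier ?M" "?c2 \<in> carrier ?M"
      using cocycle_closed u by simp_all
    have \<pi>v: "?\<pi> v2 \<in> H"
      using \<pi>.hom_closed[OF v(2)] by simp
    have "C.cocycle ?u \<one> = ?c1 \<otimes>\<^bsub>?M\<^esub> ?c2"
      using C.cocycle_mult[OF u G.one_closed] cocycle_invariant[OF u(1) \<pi>v] \<pi>v uv
      by (simp add: mult_free_group)
    moreover have "?c1 \<otimes>\<^bsub>?M\<^esub> ?c2 \<otimes>\<^bsub>?M\<^esub> inv\<^bsub>?M\<^esub> (v1 \<otimes>\<^bsub>?M\<^esub> v2) =
        (?c1 \<otimes>\<^bsub>?M\<^esub> (?c2 \<otimes>\<^bsub>?M\<^esub> inv\<^bsub>?M\<^esub> v2) \<otimes>\<^bsub>?M\<^esub> inv\<^bsub>?M\<^esub> ?c1) \<otimes>\<^bsub>?M\<^esub> (?c1 \<otimes>\<^bsub>?M\<^esub> inv\<^bsub>?M\<^esub> v1)"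
      using c v by (simp add: M.inv_mult_group M.m_assoc M.inv_cancel_left)
    moreover have "\<dots> \<in> ?N"
      using N.m_closed[OF N.inv_op_closed2[OF c(1) N(2)] N(1)] .
    moreover have "C.eval ?u = ?\<pi> (v1 \<otimes>\<^bsub>?M\<^esub> v2)"
      using u v uv by simp
    ultimately show "v1 \<otimes>\<^bsub>?M\<^esub> v2 \<in> ?L"
      using v u by (auto intro!: bexI[of _ ?u])
  qed auto
  moreover have "[(True, t)] \<in> ?L" if "t \<in> T" for t
    using that gen w eval_w \<pi>_generator R'_subset by (auto simp: R'_def intro!: bexI[of _ "w t"])
  ultimately have L: "carrier ?M \<subseteq> ?L"
    by (rule free_group_subset_subgroup)
  have "kernel ?M ?K ?\<pi> \<subseteq> ?N"
  proof
    fix v assume "v \<in> kernel ?M ?K ?\<pi>"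
    then have v: "v \<in> carrier ?M" and \<pi>v: "?\<pi> v = \<one>"
      by (auto simp: kernel_def)
    with L obtain u where u: "u \<in> carrier (free_group S)" and eval_u: "C.eval u = \<one>"
      and N: "C.cocycle u \<one> \<otimes>\<^bsub>?M\<^esub> inv\<^bsub>?M\<^esub> v \<in> ?N"
      by (smt (verit, best) mem_Collect_eq subset_iff)
    have "u \<in> normal_closure (free_group S) R"
      using u eval_u by (simp add: ker [symmetric] kernel_def)
    then have c: "C.cocycle u \<one> \<in> ?N"
      using C.cocycle_in_normal_subgroup[OF N.normal_axioms R cocycle_R eval_R _ G.one_closed] by blast
    have "inv\<^bsub>?M\<^esub> (inv\<^bsub>?M\<^esub> C.cocycle u \<one> \<otimes>\<^bsub>?M\<^esub> (C.cocycle u \<one> \<otimes>\<^bsub>?M\<^esub> inv\<^bsub>?M\<^esub> v)) = v"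
      using v N.mem_carrier[OF c] by (simp add: M.inv_cancel_left)
    then show "v \<in> ?N"
      using N.m_inv_closed[OF N.m_closed[OF N.m_inv_closed[OF c] N]] by simp
  qed
  with N_kernel have "kernel ?M ?K ?\<pi> = ?N"
    by blast
  moreover have "?\<pi> ` carrier ?M = carrier ?K"
  proof
    show "carrier ?K \<subseteq> ?\<pi> ` carrier ?M"
    proof
      fix h assume "h \<in> carrier ?K"
      then have h: "h \<in> H"
        by simp
      then obtain u where u: "u \<in> carrier (free_group S)" and eval_u: "C.eval u = h"
        using lift[OF H.mem_carrier[OF h]] by (elim exE conjE)
      then have "?\<pi> (C.cocycle u \<one>) = h"
        using \<pi>_cocycle[OF u G.one_closed] h r_one r_id by simp
      then show "h \<in> ?\<pi> ` carrier ?M"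
        using cocycle_closed[OF u G.one_closed] by (rule image_eqI[OF sym])
    qed
    show "?\<pi> ` carrier ?M \<subseteq> carrier ?K"
      using \<pi>.hom_closed by (intro image_subsetI)
  qed
  moreover have "e ` T \<subseteq> carrier ?K"
    using e_closed by (simp add: image_subset_iff)
  moreover have "finite T"
    by (simp add: T_def)
  ultimately show ?thesis
    unfolding finitely_presented_iff_free_eval[OF K.group_axioms]
    using \<open>finite R'\<close> R'_closed
    by (intro exI[of _ T] exI[of _ e] exI[of _ R'] conjI)
qed

section \<open>Dynamics of a 3-discontinuous action\<close>

text \<open>Compact sets of triples are needed only in this form, in which the three points cannot collide.\<close>

lemma compactin_Theta_3:
  assumes "compact_space X"
    and closed: "closedin X K1" "closedin X K2" "closedin X K3"
    and disjoint: "K1 \<inter> K2 = {}" "K1 \<inter> K3 = {}" "K2 \<inter> K3 = {}"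
  shows "compactin (Theta 3 X) {{x, y, z} |x y z. x \<in> K1 \<and> y \<in> K2 \<and> z \<in> K3}"
proof -
  define K where "K i = (if i = 0 then K1 else if i = 1 then K2 else K3)" for i :: nat
  have three: "{..<3::nat} = {0, 1, 2}"
    by auto
  have "compactin (product_topology (\<lambda>_. X) {..<3}) (PiE {..<3} K)"
    using assms(1) closed by (auto simp: compactin_PiE K_def closedin_compact_space)
  moreover have "PiE {..<3} K \<subseteq> {h. inj_on h {..<3}}"
  proof
    fix h assume "h \<in> PiE {..<3} K"
    then have "h 0 \<in> K1" "h 1 \<in> K2" "h 2 \<in> K3"
      by (auto simp: PiE_iff three K_def)
    then have "h 0 \<noteq> h 1" "h 0 \<noteq> h 2" "h 1 \<noteq> h 2"
      using disjoint by auto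
    then show "h \<in> {h. inj_on h {..<3}}"
      by (auto simp: three inj_on_def)
  qed
  ultimately have "compactin (Conf 3 X) (PiE {..<3} K)"
    by (simp add: Conf_def compactin_subtopology)
  then have "compactin (Theta 3 X) ((\<lambda>h. h ` {..<3}) ` PiE {..<3} K)"
    using quotient_map_Theta quotient_imp_continuous_map image_compactin by blast
  moreover have "(\<lambda>h. h ` {..<3}) ` PiE {..<3} K = {{x, y, z} |x y z. x \<in> K1 \<and> y \<in> K2 \<and> z \<in> K3}"
  proof (intro equalityI subsetI)
    fix s assume "s \<in> (\<lambda>h. h ` {..<3}) ` PiE {..<3} K"
    then obtain h where "h \<in> PiE {..<3} K" "s = {h 0, h 1, h 2}"
      by (auto simp: three)
    then show "s \<in> {{x, y, z} |x y z. x \<in> K1 \<and> y \<in> K2 \<and> z \<in> K3}"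
      by (force simp: PiE_iff three K_def)
  next
    fix s assume "s \<in> {{x, y, z} |x y z. x \<in> K1 \<and> y \<in> K2 \<and> z \<in> K3}"
    then obtain x y z where s: "s = {x, y, z}" and mem: "x \<in> K1" "y \<in> K2" "z \<in> K3"
      by blast
    define h where "h = restrict (\<lambda>i::nat. if i = 0 then x else if i = 1 then y else z) {..<3}"
    have "h \<in> PiE {..<3} K" "h ` {..<3} = s"
      using mem s by (auto simp: h_def K_def three)
    then show "s \<in> (\<lambda>h. h ` {..<3}) ` PiE {..<3} K"
      by blast
  qed
  ultimately show ?thesis
    by simp
qed

locale three_discontinuous_action = action: group_action G "topspace X" \<phi>
  for G :: "('g, 'm) monoid_scheme" (structure) and X :: "'x topology" and \<phi> :: "'g \<Rightarrow> 'x \<Rightarrow> 'x" +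
  assumes compact: "compact_space X" and Hausdorff: "Hausdorff_space X"
    and homeomorphic: "\<And>g. g \<in> carrier G \<Longrightarrow> homeomorphic_map X X (\<phi> g)"
    and three_discontinuous: "n_discontinuous 3 X (carrier G) \<phi>"
begin

sublocale group G
  using action.group_hom by (simp add: group_hom_def)

lemma image_closed: "g \<in> carrier G \<Longrightarrow> x \<in> topspace X \<Longrightarrow> \<phi> g x \<in> topspace X"
  by (rule action.element_image[OF _ _ refl])

text \<open>The usable form of 3-discontinuity: apply it to the union of a compact set of source triples and
  a compact set of target triples.\<close>

lemma finite_triple_transporter:
  assumes "closedin X K1" "closedin X K2" "closedin X K3"
    and "K1 \<inter> K2 = {}" "K1 \<inter> K3 = {}" "K2 \<inter> K3 = {}"
    and "closedin X L1" "closedin X L2" "closedin X L3"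
    and "L1 \<inter> L2 = {}" "L1 \<inter> L3 = {}" "L2 \<inter> L3 = {}"
  shows "finite {g \<in> carrier G. \<exists>x\<in>K1. \<exists>y\<in>K2. \<exists>z\<in>K3. \<phi> g x \<in> L1 \<and> \<phi> g y \<in> L2 \<and> \<phi> g z \<in> L3}"
proof -
  let ?T = "\<lambda>K1 K2 K3. {{x, y, z} |x y z. x \<in> K1 \<and> y \<in> K2 \<and> z \<in> K3}"
  let ?C = "?T K1 K2 K3 \<union> ?T L1 L2 L3"
  have "compactin (Theta 3 X) ?C"
    using assms compactin_Theta_3[OF compact] by (intro compactin_Un) auto
  then have "finite {g \<in> carrier G. (\<lambda>S. \<phi> g ` S) ` ?C \<inter> ?C \<noteq> {}}"
    using three_discontinuous by (simp only: n_discontinuous_def properly_discontinuous_def)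
  moreover have "{g \<in> carrier G. \<exists>x\<in>K1. \<exists>y\<in>K2. \<exists>z\<in>K3. \<phi> g x \<in> L1 \<and> \<phi> g y \<in> L2 \<and> \<phi> g z \<in> L3}
      \<subseteq> {g \<in> carrier G. (\<lambda>S. \<phi> g ` S) ` ?C \<inter> ?C \<noteq> {}}" (is "?A \<subseteq> ?B")
  proof
    fix g assume "g \<in> ?A"
    then obtain x y z where g: "g \<in> carrier G" and xyz: "x \<in> K1" "y \<in> K2" "z \<in> K3"
      and image: "\<phi> g x \<in> L1" "\<phi> g y \<in> L2" "\<phi> g z \<in> L3"
      by blast
    have "{x, y, z} \<in> ?C"
      using xyz by blast
    then have "\<phi> g ` {x, y, z} \<in> (\<lambda>S. \<phi> g ` S) ` ?C"
      by (rule imageI)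
    moreover have "\<phi> g ` {x, y, z} \<in> ?C"
      using image by auto
    ultimately have "\<phi> g ` {x, y, z} \<in> (\<lambda>S. \<phi> g ` S) ` ?C \<inter> ?C"
      by (rule IntI)
    then have "(\<lambda>S. \<phi> g ` S) ` ?C \<inter> ?C \<noteq> {}"
      by (metis empty_iff)
    with g show "g \<in> ?B"
      by simp
  qed
  ultimately show ?thesis
    by (rule rev_finite_subset)
qed

text \<open>Every point \<open>y\<close> of \<open>C\<close> has a neighbourhood \<open>U\<close> with finitely many returns. If \<open>g0\<close> and \<open>g\<close> both
  move \<open>x\<close> into \<open>U\<close>, then \<open>g \<otimes> inv g0\<close> is such a return; so only finitely many elements move \<open>x\<close> into
  \<open>U\<close>, and finitely many such neighbourhoods cover \<open>C\<close>.\<close>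

lemma finite_transporter_compact:
  assumes L: "subgroup L G" and x: "x \<in> topspace X"
    and C: "compactin X C" "C \<subseteq> discontinuity_domain X L \<phi>"
  shows "finite {g \<in> L. \<phi> g x \<in> C}"
proof -
  interpret L: subgroup L G by fact
  let ?\<U> = "{U. openin X U \<and> finite {g \<in> L. \<phi> g ` U \<inter> U \<noteq> {}}}"
  have local: "finite {g \<in> L. \<phi> g x \<in> U}" if U: "U \<in> ?\<U>" for U
  proof (cases "\<exists>g0\<in>L. \<phi> g0 x \<in> U")
    case True
    then obtain g0 where g0: "g0 \<in> L" "\<phi> g0 x \<in> U"
      by blast
    have "g \<otimes> inv g0 \<in> {g \<in> L. \<phi> g ` U \<inter> U \<noteq> {}}" if g: "g \<in> L" "\<phi> g x \<in> U" for g
    proof -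
      have "\<phi> (g \<otimes> inv g0) (\<phi> g0 x) = \<phi> g x"
        using g g0 x L.mem_carrier action.composition_rule[of x "g \<otimes> inv g0" g0]
        by (simp add: m_assoc)
      then show ?thesis
        using g g0 by force
    qed
    then have "(\<lambda>g. g \<otimes> inv g0) ` {g \<in> L. \<phi> g x \<in> U} \<subseteq> {g \<in> L. \<phi> g ` U \<inter> U \<noteq> {}}"
      by blast
    moreover have "inj_on (\<lambda>g. g \<otimes> inv g0) {g \<in> L. \<phi> g x \<in> U}"
      using g0 by (auto simp: inj_on_def)
    ultimately show ?thesis
      using U by (metis (no_types, lifting) finite_subset finite_imageD mem_Collect_eq)
  next
    case False
    then have "{g \<in> L. \<phi> g x \<in> U} = {}"
      by blast
    then show ?thesis
      by (metis finite.emptyI)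
  qed
  have "C \<subseteq> \<Union>?\<U>"
    using C(2) by (auto simp: discontinuity_domain_def)
  then obtain \<F> where \<F>: "finite \<F>" "\<F> \<subseteq> ?\<U>" "C \<subseteq> \<Union>\<F>"
    using C(1) unfolding compactin_def by (metis (no_types, lifting) mem_Collect_eq)
  have "finite (\<Union>U\<in>\<F>. {g \<in> L. \<phi> g x \<in> U})"
    using \<F> local by blast
  then show ?thesis
    by (rule rev_finite_subset) (use \<F>(3) in blast)
qed

lemma openin_discontinuity_domain: "openin X (discontinuity_domain X L \<phi>)"
proof (subst openin_subopen, intro ballI)
  fix x assume "x \<in> discontinuity_domain X L \<phi>"
  then obtain U where "openin X U" "x \<in> U" "finite {g \<in> L. \<phi> g ` U \<inter> U \<noteq> {}}"
    by (auto simp: discontinuity_domain_def)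
  then show "\<exists>T. openin X T \<and> x \<in> T \<and> T \<subseteq> discontinuity_domain X L \<phi>"
    by (auto simp: discontinuity_domain_def)
qed

lemma inverse_image_iff:
  assumes "g \<in> carrier G" "x \<in> topspace X" "y \<in> topspace X"
  shows "\<phi> (inv g) x = y \<longleftrightarrow> \<phi> g y = x"
proof
  assume "\<phi> (inv g) x = y"
  then show "\<phi> g y = x"
    using action.orbit_sym_aux[of "inv g" x y] assms by simp
next
  assume "\<phi> g y = x"
  then show "\<phi> (inv g) x = y"
    using assms(1,3) by (rule action.orbit_sym_aux[rotated 2])
qed

lemma discontinuity_domain_invariant:
  assumes g: "g \<in> carrier G" and x: "x \<in> discontinuity_domain X (carrier G) \<phi>"
  shows "\<phi> g x \<in> discontinuity_domain X (carrier G) \<phi>"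
proof -
  let ?R = "\<lambda>U. {k \<in> carrier G. \<phi> k ` U \<inter> U \<noteq> {}}"
  obtain U where U: "openin X U" "x \<in> U" "finite (?R U)"
    using x by (auto simp: discontinuity_domain_def)
  have "?R (\<phi> g ` U) \<subseteq> (\<lambda>k. g \<otimes> k \<otimes> inv g) ` ?R U"
  proof
    fix k assume "k \<in> ?R (\<phi> g ` U)"
    then obtain y z where k: "k \<in> carrier G" and yz: "y \<in> U" "z \<in> U" "\<phi> k (\<phi> g y) = \<phi> g z"
      by blast
    have top: "y \<in> topspace X" "z \<in> topspace X"
      using yz U(1) openin_subset by blast+
    have "\<phi> (inv g \<otimes> (k \<otimes> g)) y = \<phi> (inv g) (\<phi> g z)"
      using g k yz top action.composition_rule by simp
    also have "\<dots> = z"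
      using g top action.orbit_sym_aux by blast
    finally have "inv g \<otimes> (k \<otimes> g) \<in> ?R U"
      using g k yz by force
    moreover have "k = g \<otimes> (inv g \<otimes> (k \<otimes> g)) \<otimes> inv g"
      using g k by (simp add: m_assoc inv_cancel_left)
    ultimately show "k \<in> (\<lambda>k. g \<otimes> k \<otimes> inv g) ` ?R U"
      by blast
  qed
  then have "finite (?R (\<phi> g ` U))"
    using U(3) by (meson finite_imageI finite_subset)
  moreover have "openin X (\<phi> g ` U)"
    using homeomorphic[OF g] U(1) by (meson homeomorphic_imp_open_map open_map_def)
  ultimately show ?thesis
    using U(2) unfolding discontinuity_domain_def by blast
qed

text \<open>
  The translates of the edge from \<open>a\<close> to \<open>b\<close> become small. To a translate that joins \<open>K\<close> to \<open>L\<close> one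
  adds the point \<open>inv g \<cdot> a\<close> as a third vertex: then \<open>g\<close> maps the triple \<open>a\<close>, \<open>b\<close>, \<open>inv g \<cdot> a\<close> to a
  triple with one vertex in \<open>K\<close>, one in \<open>L\<close> and one at \<open>a\<close>. Because \<open>a\<close> and \<open>b\<close> are isolated, all these
  triples lie in a compact set, except for the finitely many \<open>g\<close> for which two vertices coincide.\<close>

lemma finite_edges_far_apart:
  assumes a: "openin X {a}" "a \<in> discontinuity_domain X (carrier G) \<phi>"
    and b: "openin X {b}"
    and K: "closedin X K" and L: "closedin X L" and "K \<inter> L = {}"
  shows "finite {g \<in> carrier G. \<phi> g a \<in> K \<and> \<phi> g b \<in> L}"
proof (cases "a = b")
  case True
  with \<open>K \<inter> L = {}\<close> show ?thesis
    by (auto intro: finite_subset[of _ "{}"])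
next
  case False
  have top: "a \<in> topspace X" "b \<in> topspace X"
    using a b openin_subset by blast+
  have "finite {g \<in> carrier G. \<phi> g x \<in> {a}}" if "x \<in> topspace X" for x
    using that a top by (intro finite_transporter_compact) (auto simp: subgroup_self)
  then have exceptional: "finite ({g \<in> carrier G. \<phi> g a \<in> {a}} \<union> {g \<in> carrier G. \<phi> g b \<in> {a}})"
    using top by blast
  \<comment> \<open>The target sets avoid \<open>a\<close>, since they have to be disjoint from the third target \<open>{a}\<close>.\<close>
  let ?P = "{g \<in> carrier G. \<exists>x\<in>{a}. \<exists>y\<in>{b}. \<exists>z\<in>topspace X - {a, b}.
    \<phi> g x \<in> K - {a} \<and> \<phi> g y \<in> L - {a} \<and> \<phi> g z \<in> {a}}"
  have "openin X {a, b}"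
    using openin_Un[OF a(1) b] by (simp add: insert_commute)
  then have generic: "finite ?P"
    using top a K L False \<open>K \<inter> L = {}\<close>
    by (intro finite_triple_transporter) (auto simp: closedin_Hausdorff_singleton Hausdorff closedin_diff)
  have "{g \<in> carrier G. \<phi> g a \<in> K \<and> \<phi> g b \<in> L}
      \<subseteq> ({g \<in> carrier G. \<phi> g a \<in> {a}} \<union> {g \<in> carrier G. \<phi> g b \<in> {a}}) \<union> ?P"
  proof
    fix g assume g: "g \<in> {g \<in> carrier G. \<phi> g a \<in> K \<and> \<phi> g b \<in> L}"
    let ?z = "\<phi> (inv g) a"
    have z: "?z \<in> topspace X" "\<phi> g ?z = a"
      using g top image_closed[of "inv g" a] inverse_image_iff[of g a ?z] by auto
    show "g \<in> ({g \<in> carrier G. \<phi> g a \<in> {a}} \<union> {g \<in> carrier G. \<phi> g b \<in> {a}}) \<union> ?P"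
    proof (cases "\<phi> g a = a \<or> \<phi> g b = a")
      case False
      then have "?z \<noteq> a" "?z \<noteq> b"
        using z by auto
      with False g z show ?thesis
        by blast
    qed (use g in blast)
  qed
  then show ?thesis
    using finite_UnI[OF exceptional generic] by (rule finite_subset)
qed

text \<open>
  The definition of the discontinuity domain gives finitely many returns to a small neighbourhood of
  each point; for arbitrary compact sets one needs more, because an action with that property may have
  a quotient that is not Hausdorff. An isolated point \<open>a\<close> witnesses both ends of the dynamics of \<open>h\<close>:
  all but finitely many \<open>h\<close> move \<open>a\<close>, and so do their inverses, out of a given compact part of the
  discontinuity domain. If also \<open>h \<cdot> x\<close> is in \<open>L\<close> for some \<open>x\<close> in \<open>K\<close>, then \<open>h\<close> maps the triple \<open>x\<close>,
  \<open>inv h \<cdot> a\<close>, \<open>a\<close> to the triple \<open>h \<cdot> x\<close>, \<open>a\<close>, \<open>h \<cdot> a\<close>, and both range over compact sets of triples.\<close>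

lemma finite_return_discontinuity_domain:
  assumes H: "subgroup H G" and a: "openin X {a}" "a \<in> discontinuity_domain X H \<phi>"
    and K: "closedin X K" "K \<subseteq> discontinuity_domain X H \<phi>"
    and L: "closedin X L" "L \<subseteq> discontinuity_domain X H \<phi>"
  shows "finite {h \<in> H. \<phi> h ` K \<inter> L \<noteq> {}}"
proof -
  interpret H: subgroup H G by fact
  let ?\<Omega> = "discontinuity_domain X H \<phi>"
  have "normal_space X"
    using compact Hausdorff compact_Hausdorff_or_regular_imp_normal_space by blast
  then have "\<exists>V. openin X V \<and> K \<union> L \<subseteq> V \<and> X closure_of V \<subseteq> ?\<Omega>"
    using K L openin_discontinuity_domain unfolding normal_space_alt by (meson Un_least closedin_Un)
  then obtain V where V: "openin X V" "K \<union> L \<subseteq> V" "X closure_of V \<subseteq> ?\<Omega>"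
    by blast
  have top: "a \<in> topspace X"
    using a openin_subset by blast
  define C where "C = X closure_of V \<union> {a}"
  have a_closed: "closedin X {a}"
    by (rule closedin_Hausdorff_singleton[OF Hausdorff top])
  have "compactin X C"
    unfolding C_def by (intro closedin_compact_space compact closedin_Un closedin_closure_of a_closed)
  have "C \<subseteq> ?\<Omega>"
    using V(3) a(2) by (simp add: C_def)
  have "V \<subseteq> C"
    using closure_of_subset[OF openin_subset[OF V(1)]] by (auto simp: C_def)
  have fin: "finite {h \<in> H. \<phi> h a \<in> C}"
    using finite_transporter_compact[OF H top \<open>compactin X C\<close> \<open>C \<subseteq> ?\<Omega>\<close>] .
  have "{h \<in> H. \<phi> (inv h) a \<in> C} \<subseteq> m_inv G ` {h \<in> H. \<phi> h a \<in> C}"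
  proof
    fix h assume "h \<in> {h \<in> H. \<phi> (inv h) a \<in> C}"
    then show "h \<in> m_inv G ` {h \<in> H. \<phi> h a \<in> C}"
      using H.mem_carrier by (intro image_eqI[of _ _ "inv h"]) auto
  qed
  then have exceptional: "finite ({h \<in> H. \<phi> h a \<in> C} \<union> {h \<in> H. \<phi> (inv h) a \<in> C})"
    using fin finite_subset[OF _ finite_imageI[OF fin]] by simp
  let ?P = "{g \<in> carrier G. \<exists>x\<in>K - {a}. \<exists>y\<in>topspace X - V - {a}. \<exists>z\<in>{a}.
    \<phi> g x \<in> L - {a} \<and> \<phi> g y \<in> {a} \<and> \<phi> g z \<in> topspace X - V - {a}}"
  have "closedin X (K - {a})" "closedin X (L - {a})" "closedin X (topspace X - V - {a})"
    using K(1) L(1) V(1) a(1) by (simp_all add: closedin_diff)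
  then have generic: "finite ?P"
    using a_closed V(2) by (intro finite_triple_transporter) blast+
  have "{h \<in> H. \<phi> h ` K \<inter> L \<noteq> {}}
      \<subseteq> ({h \<in> H. \<phi> h a \<in> C} \<union> {h \<in> H. \<phi> (inv h) a \<in> C}) \<union> ?P"
  proof
    fix h assume "h \<in> {h \<in> H. \<phi> h ` K \<inter> L \<noteq> {}}"
    then obtain x where h: "h \<in> H" and x: "x \<in> K" "\<phi> h x \<in> L"
      by blast
    note hG = H.mem_carrier[OF h]
    have x_top: "x \<in> topspace X"
      using x K closedin_subset by blast
    have ha_top: "\<phi> h a \<in> topspace X" "\<phi> (inv h) a \<in> topspace X"
      using image_closed[OF hG top] image_closed[OF inv_closed[OF hG] top] by simp_all
    show "h \<in> ({h \<in> H. \<phi> h a \<in> C} \<union> {h \<in> H. \<phi> (inv h) a \<in> C}) \<union> ?P"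
    proof (cases "\<phi> h a \<in> C \<or> \<phi> (inv h) a \<in> C")
      case False
      then have "\<phi> h a \<notin> V" "\<phi> h a \<noteq> a" "\<phi> (inv h) a \<notin> V" "\<phi> (inv h) a \<noteq> a"
        using \<open>V \<subseteq> C\<close> by (auto simp: C_def)
      moreover have "\<phi> h (\<phi> (inv h) a) = a"
        using hG top ha_top inverse_image_iff[of h a] by blast
      moreover have "x \<noteq> a"
        using x V \<open>\<phi> h a \<notin> V\<close> by auto
      moreover have "\<phi> h x \<noteq> a"
        using x V hG top x_top \<open>\<phi> (inv h) a \<notin> V\<close> inverse_image_iff[of h a x] by auto
      ultimately show ?thesis
        using h hG x ha_top by blast
    qed (use h in blast)
  qed
  then show ?thesis
    using finite_UnI[OF exceptional generic] by (rule finite_subset)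
qed

text \<open>
  Let \<open>K\<close> be a compact set whose \<open>H\<close>-translates cover the discontinuity domain of \<open>H\<close>. The map \<open>r\<close>
  chooses, for each \<open>g\<close>, an element of \<open>H\<close> that moves \<open>inv g \<cdot> a\<close> into \<open>K\<close>. Along an edge from \<open>g\<close> to
  \<open>s \<otimes> g\<close> the chosen elements differ by finitely many factors: move the edge from \<open>inv g \<cdot> a\<close> to
  \<open>inv (s \<otimes> g) \<cdot> a\<close> by \<open>r g\<close>, so that it begins in \<open>K\<close>. As edges become small, it also ends in a
  fixed slightly larger compact set, up to finitely many exceptions, and only finitely many elements of
  \<open>H\<close> bring a point of such a set back to \<open>K\<close>.\<close>

lemma coarse_retraction_exists:
  assumes H: "subgroup H G"
    and cocompact: "cocompact (subtopology X (discontinuity_domain X H \<phi>)) H \<phi>"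
    and a: "a \<in> discontinuity_domain X (carrier G) \<phi>"
    and discrete: "\<And>x. x \<in> discontinuity_domain X (carrier G) \<phi> \<Longrightarrow> openin X {x}"
  obtains r where "\<And>g. g \<in> carrier G \<Longrightarrow> r g \<in> H"
    and "\<And>g h. g \<in> carrier G \<Longrightarrow> h \<in> H \<Longrightarrow> r (g \<otimes> h) = r g \<otimes> h"
    and "r \<one> = \<one>"
    and "\<And>s. s \<in> carrier G \<Longrightarrow> finite ((\<lambda>g. r (s \<otimes> g) \<otimes> inv r g) ` carrier G)"
proof -
  interpret H: subgroup H G by fact
  let ?\<Omega> = "discontinuity_domain X H \<phi>"
  have top: "a \<in> topspace X"
    using a by (auto simp: discontinuity_domain_def dest: openin_subset)
  have one: "\<phi> \<one> x = x" if "x \<in> topspace X" for x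
    using that action.id_eq_one by (metis restrict_apply')
  have \<Omega>_subset: "discontinuity_domain X (carrier G) \<phi> \<subseteq> ?\<Omega>"
  proof -
    have "finite {g \<in> H. \<phi> g ` U \<inter> U \<noteq> {}}" if "finite {g \<in> carrier G. \<phi> g ` U \<inter> U \<noteq> {}}" for U
      using that by (rule rev_finite_subset) (use H.mem_carrier in blast)
    then show ?thesis
      by (auto simp: discontinuity_domain_def)
  qed
  have orbit: "\<phi> g a \<in> ?\<Omega>" if "g \<in> carrier G" for g
    using discontinuity_domain_invariant[OF that a] \<Omega>_subset by blast
  obtain K0 where K0: "compactin X K0" "K0 \<subseteq> ?\<Omega>" "(\<Union>h\<in>H. \<phi> h ` K0) = topspace X \<inter> ?\<Omega>"
    using cocompact by (auto simp: cocompact_def compactin_subtopology topspace_subtopology)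
  define K where "K = insert a K0"
  have aK: "a \<in> K"
    by (simp add: K_def)
  have "compactin X K"
    using compactin_Un[OF finite_imp_compactin[of "{a}" X] K0(1)] top by (simp add: K_def)
  then have K: "closedin X K" "K \<subseteq> ?\<Omega>"
    using Hausdorff K0(2) a \<Omega>_subset by (auto simp: compactin_imp_closedin K_def)
  have reach: "\<exists>h\<in>H. \<phi> (h \<otimes> inv g) a \<in> K" if g: "g \<in> carrier G" for g
  proof -
    have "\<phi> (inv g) a \<in> (\<Union>h\<in>H. \<phi> h ` K0)"
      using K0(3) orbit[of "inv g"] g openin_subset[OF openin_discontinuity_domain, of H] by auto
    then obtain h x where h: "h \<in> H" and x: "x \<in> K0" "\<phi> h x = \<phi> (inv g) a"
      by auto
    then have "\<phi> (inv h) (\<phi> (inv g) a) = x"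
      using action.orbit_sym_aux[of h x] K0(1) compactin_subset_topspace H.mem_carrier by blast
    then show ?thesis
      using h x g top H.mem_carrier action.composition_rule[of a "inv h" "inv g"]
      by (intro bexI[of _ "inv h"]) (auto simp: K_def)
  qed
  \<comment> \<open>Choosing a representative \<open>t g\<close> of each coset and extending along the coset makes \<open>r\<close> equivariant.
    In the coset \<open>H\<close> the choice of \<open>u\<close> makes \<open>r\<close> the identity; it is admissible because \<open>a\<close> is in \<open>K\<close>.\<close>
  define t where "t g = (SOME t. t \<in> g <# H)" for g
  define u where "u g = (if g \<in> H then g else SOME h. h \<in> H \<and> \<phi> (h \<otimes> inv g) a \<in> K)" for g
  define r where "r g = u (t g) \<otimes> (inv t g \<otimes> g)" for g
  have t_coset: "t g \<in> g <# H" if "g \<in> carrier G" for g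
  proof -
    have "g \<otimes> \<one> \<in> g <# H"
      using H.one_closed by (force simp: l_coset_def)
    then show ?thesis
      unfolding t_def by (rule someI)
  qed
  have t: "t g \<in> carrier G" "inv t g \<otimes> g \<in> H" if g: "g \<in> carrier G" for g
  proof -
    obtain h where "h \<in> H" "t g = g \<otimes> h"
      using t_coset[OF g] by (auto simp: l_coset_def)
    then show "t g \<in> carrier G" "inv t g \<otimes> g \<in> H"
      using g H.mem_carrier by (simp_all add: inv_mult_group m_assoc)
  qed
  have t_mult: "t (g \<otimes> h) = t g" if "g \<in> carrier G" "h \<in> H" for g h
  proof -
    have "(g \<otimes> h) <# H = g <# H"
      using that H H.mem_carrier l_repr_independence[of "g \<otimes> h" g H] by (auto simp: l_coset_def)
    then show ?thesis
      by (simp add: t_def)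
  qed
  have u: "u g \<in> H" "\<phi> (u g \<otimes> inv g) a \<in> K" if g: "g \<in> carrier G" for g
  proof -
    have "u g \<in> H \<and> \<phi> (u g \<otimes> inv g) a \<in> K"
    proof (cases "g \<in> H")
      case True
      with g show ?thesis
        by (simp add: u_def one top aK)
    next
      case False
      have "\<exists>h. h \<in> H \<and> \<phi> (h \<otimes> inv g) a \<in> K"
        using reach[OF g] by blast
      from someI_ex[OF this] False show ?thesis
        by (simp add: u_def)
    qed
    then show "u g \<in> H" "\<phi> (u g \<otimes> inv g) a \<in> K"
      by auto
  qed
  have r_closed: "r g \<in> H" if "g \<in> carrier G" for g
    using t[OF that] u by (simp add: r_def)
  have r_K: "\<phi> (r g \<otimes> inv g) a \<in> K" if g: "g \<in> carrier G" for g
  proof -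
    have "r g \<otimes> inv g = u (t g) \<otimes> inv t g"
      using g t[OF g] u[OF t(1)[OF g]] H.mem_carrier by (simp add: r_def m_assoc)
    then show ?thesis
      using u(2)[OF t(1)[OF g]] by simp
  qed
  have r_mult: "r (g \<otimes> h) = r g \<otimes> h" if "g \<in> carrier G" "h \<in> H" for g h
    using that t[of g] u[of "t g"] H.mem_carrier by (simp add: r_def t_mult m_assoc)
  have "t \<one> \<in> H"
    using t_coset[of \<one>] H.mem_carrier by (auto simp: l_coset_def)
  then have r_one: "r \<one> = \<one>"
    using H.mem_carrier by (simp add: r_def u_def)
  have "finite ((\<lambda>g. r (s \<otimes> g) \<otimes> inv r g) ` carrier G)" if s: "s \<in> carrier G" for s
  proof -
    have "normal_space X"
      using compact Hausdorff compact_Hausdorff_or_regular_imp_normal_space by blast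
    then obtain V where V: "openin X V" "K \<subseteq> V" "X closure_of V \<subseteq> ?\<Omega>"
      using K openin_discontinuity_domain unfolding normal_space_alt by meson
    have V_closure: "V \<subseteq> X closure_of V"
      by (simp add: V(1) closure_of_subset openin_subset)
    \<comment> \<open>The edge at \<open>g\<close> is the translate by \<open>inv g\<close> of the edge from \<open>a\<close> to \<open>b\<close>. The set \<open>B\<close> contains the
      far ends of all translates that begin in \<open>K\<close>.\<close>
    define b where "b = \<phi> (inv s) a"
    define E where "E = {g \<in> carrier G. \<phi> g a \<in> K \<and> \<phi> g b \<in> topspace X - V}"
    define B where "B = X closure_of V \<union> (\<lambda>g. \<phi> g b) ` E"
    have "finite E"
      unfolding E_def b_def using discrete discontinuity_domain_invariant s a K(1) V
      by (intro finite_edges_far_apart) (auto simp: one top closedin_diff)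
    have b_top: "b \<in> topspace X"
      unfolding b_def using image_closed[OF inv_closed[OF s] top] by simp
    have gb: "\<phi> g b = \<phi> (g \<otimes> inv s) a" if "g \<in> carrier G" for g
      unfolding b_def using that s top action.composition_rule by simp
    have "B \<subseteq> ?\<Omega>"
      unfolding B_def using V(3) orbit gb s by (auto simp: E_def)
    moreover have "closedin X B"
      unfolding B_def using \<open>finite E\<close> b_top Hausdorff image_closed
      by (intro closedin_Un closedin_closure_of closedin_Hausdorff_finite) (auto simp: E_def)
    ultimately have "finite {k \<in> H. \<phi> k ` B \<inter> K \<noteq> {}}"
      using finite_return_discontinuity_domain[OF H _ _ _ _ K] discrete[OF a] a \<Omega>_subset
      by (auto simp: one top)
    moreover have "r (s \<otimes> g) \<otimes> inv r g \<in> {k \<in> H. \<phi> k ` B \<inter> K \<noteq> {}}" if g: "g \<in> carrier G" for g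
    proof -
      \<comment> \<open>The translation \<open>c\<close> moves the edge at \<open>g\<close> so that it begins in \<open>K\<close>; then \<open>k\<close> returns its other
        end to \<open>K\<close>.\<close>
      define k where "k = r (s \<otimes> g) \<otimes> inv r g"
      define c where "c = r g \<otimes> inv g"
      have rG: "r g \<in> carrier G" "r (s \<otimes> g) \<in> carrier G"
        using r_closed g s H.mem_carrier by auto
      have k: "k \<in> H" and c: "c \<in> carrier G"
        using r_closed g s rG by (auto simp: k_def c_def)
      have "\<phi> c b \<in> B"
      proof (cases "\<phi> c b \<in> V")
        case False
        then have "c \<in> E"
          using c r_K[OF g] image_closed[OF c b_top] False by (simp add: E_def c_def)
        then show ?thesis
          by (simp add: B_def)
      qed (use V_closure in \<open>auto simp: B_def\<close>)
      moreover have "\<phi> k (\<phi> c b) \<in> K"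
      proof -
        have "k \<otimes> c \<otimes> inv s = r (s \<otimes> g) \<otimes> inv (s \<otimes> g)"
          using rG g s by (simp add: k_def c_def inv_mult_group m_assoc inv_cancel_left)
        moreover have "\<phi> k (\<phi> c b) = \<phi> (k \<otimes> c \<otimes> inv s) a"
          using gb[of "k \<otimes> c"] action.composition_rule[OF b_top, of k c] k c H.mem_carrier by simp
        ultimately show ?thesis
          using r_K[of "s \<otimes> g"] s g by simp
      qed
      ultimately show ?thesis
        using k by (auto simp: k_def)
    qed
    ultimately show ?thesis
      by (meson finite_subset image_subsetI)
  qed
  with r_closed r_mult r_one show ?thesis
    using that by blast
qed

end

section \<open>Subgroups that act cocompactly off their limit set\<close>

theorem proposition9p2p1:
  fixes G :: "('g, 'm) monoid_scheme"
    and X :: "'x topology"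
    and \<phi> :: "'g \<Rightarrow> 'x \<Rightarrow> 'x"
    and A :: "'x set"
    and H :: "'g set"
  assumes "compact_space X" and "Hausdorff_space X"
    and "finite (topspace X) \<longrightarrow> card (topspace X) > 2"
    and "group_action G (topspace X) \<phi>"
    and "\<And>g. g \<in> carrier G \<Longrightarrow> homeomorphic_map X X (\<phi> g)"
    and "n_discontinuous 3 X (carrier G) \<phi>"
    and "n_cocompact 2 X (carrier G) \<phi>"
    and "A = discontinuity_domain X (carrier G) \<phi>"
    and "A \<noteq> {}"
    and "subtopology X A = discrete_topology A"
    and "finite (orbits G A \<phi>)"
    and "subgroup H G"
    and "cocompact (subtopology X (topspace X - limit_set X H \<phi>)) H \<phi>"
    and "finitely_presented G"
  shows "finitely_presented (G\<lparr>carrier := H\<rparr>)"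
proof -
  interpret three_discontinuous_action G X \<phi>
    using assms(1,2,4-6)
    by (simp add: three_discontinuous_action_def three_discontinuous_action_axioms_def)
  obtain a where a: "a \<in> discontinuity_domain X (carrier G) \<phi>"
    using assms(8,9) by blast
  have discrete: "openin X {x}" if "x \<in> discontinuity_domain X (carrier G) \<phi>" for x
  proof -
    have "openin (subtopology X A) {x}"
      using that assms(8,10) by simp
    then show ?thesis
      using assms(8) openin_discontinuity_domain openin_open_subtopology by blast
  qed
  have "discontinuity_domain X H \<phi> \<subseteq> topspace X"
    using openin_discontinuity_domain openin_subset by blast
  then have "topspace X - limit_set X H \<phi> = discontinuity_domain X H \<phi>"
    by (auto simp: limit_set_def)
  then have "cocompact (subtopology X (discontinuity_domain X H \<phi>)) H \<phi>"
    using assms(13) by simp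
  then obtain r where "\<And>g. g \<in> carrier G \<Longrightarrow> r g \<in> H"
    and "\<And>g h. g \<in> carrier G \<Longrightarrow> h \<in> H \<Longrightarrow> r (g \<otimes>\<^bsub>G\<^esub> h) = r g \<otimes>\<^bsub>G\<^esub> h"
    and "r \<one>\<^bsub>G\<^esub> = \<one>\<^bsub>G\<^esub>"
    and "\<And>s. s \<in> carrier G \<Longrightarrow> finite ((\<lambda>g. r (s \<otimes>\<^bsub>G\<^esub> g) \<otimes>\<^bsub>G\<^esub> inv\<^bsub>G\<^esub> r g) ` carrier G)"
    using coarse_retraction_exists[OF assms(12) _ a discrete] by metis
  then show ?thesis
    using finitely_presented_coarse_retract[OF group_axioms assms(12) _ _ _ _ assms(14)] by blast
qed

end
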